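(* Let $s\ge 1$ and $t\ge 3$ be fixed integers. Then, for all sufficiently large $n$, $$\mathrm{ex}(n,\{J_t,M_{s+1}^3\})=s\cdot t(n-s,t-1)+O(n),$$ where the implied constant may depend on $s$ and $t$ but not on $n$. In particular, for $t=3$ (where $J_3=K_4^{3-}$), for $s\in\{1,2\}$ and every $n\ge 150$, $$\mathrm{ex}(n,\{K_4^{3-},M_{s+1}^3\})=\begin{cases} 2\left\lfloor\frac{(n-2)^2}{4}\right\rfloor+1, & \text{if } s=2 \text{ and } n \text{ is odd},\\[2pt] s\left\lfloor\frac{(n-s)^2}{4}\right\rfloor, & \text{otherwise}.\end{cases}$$
   Context: A $3$-graph is a $3$-uniform hypergraph. For a family $\mathcal{F}$ of $3$-graphs, $\mathrm{ex}(n,\mathcal{F})$ is the maximum number of edges in an $n$-vertex $3$-graph containing no member of $\mathcal{F}$ as a (not necessarily induced) subgraph. $M_{s+1}^3$ is the $3$-graph consisting of $s+1$ pairwise disjoint edges. The full star $J_t$ is the $3$-graph on $t+1$ vertices, consisting of a center vertex $v_0$ and $t$ other vertices, whose edges are all triples containing $v_0$. $K_4^{3-}$ is the $3$-graph obtained from the complete $3$-graph on $4$ vertices by removing one edge; it is isomorphic to $J_3$. $t(n,k)$ is the number of edges of the Turán graph $T(n,k)$, the complete $k$-partite graph on $n$ vertices whose part sizes differ by at most $1$ (the parameter $t$ and the function $t(\cdot,\cdot)$ are different objects). *)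

theory Defs
  imports Complex_Main "HOL-Library.Landau_Symbols"
begin

text \<open>A hypergraph is a pair of a vertex set and an edge set.\<close>

type_synonym 'a hypergraph = "'a set \<times> 'a set set"

abbreviation verts :: "'a hypergraph \<Rightarrow> 'a set" where
  "verts H \<equiv> fst H"

abbreviation edges :: "'a hypergraph \<Rightarrow> 'a set set" where
  "edges H \<equiv> snd H"

definition three_graph :: "'a hypergraph \<Rightarrow> bool" where
  "three_graph H \<longleftrightarrow> finite (verts H) \<and> (\<forall>e\<in>edges H. e \<subseteq> verts H \<and> card e = 3)"

text \<open>Containment as a not necessarily induced subgraph, up to isomorphism.\<close>

definition contains_copy :: "'a hypergraph \<Rightarrow> 'b hypergraph \<Rightarrow> bool" where
  "contains_copy H F \<longleftrightarrow>
     (\<exists>f. inj_on f (verts F) \<and> f ` verts F \<subseteq> verts H \<and> (\<forall>e\<in>edges F. f ` e \<in> edges H))"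

definition ex3 :: "nat \<Rightarrow> 'b hypergraph set \<Rightarrow> nat" where
  "ex3 n \<F> = Max {card (edges H) | H :: nat hypergraph.
     three_graph H \<and> card (verts H) = n \<and> (\<forall>F\<in>\<F>. \<not> contains_copy H F)}"

text \<open>The \<open>Max\<close> in \<^const>\<open>ex3\<close> is always taken over a finite set; it is nonempty as soon as
  every member of the family has an edge.\<close>

lemma finite_ex3:
  "finite {card (edges H) | H :: nat hypergraph.
     three_graph H \<and> card (verts H) = n \<and> (\<forall>F\<in>\<F>. \<not> contains_copy H F)}"
proof (rule finite_subset)
  show "{card (edges H) | H :: nat hypergraph.
     three_graph H \<and> card (verts H) = n \<and> (\<forall>F\<in>\<F>. \<not> contains_copy H F)} \<subseteq> {..2 ^ n}"
  proof clarsimp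
    fix V :: "nat set" and E
    assume "three_graph (V, E)"
    then have "E \<subseteq> Pow V" "finite V" by (auto simp: three_graph_def)
    then have "card E \<le> card (Pow V)" by (intro card_mono) auto
    then show "card E \<le> 2 ^ card V" using \<open>finite V\<close> by (simp add: card_Pow)
  qed
qed simp

lemma nonempty_ex3:
  assumes "\<And>F. F \<in> \<F> \<Longrightarrow> edges F \<noteq> {}"
  shows "{card (edges H) | H :: nat hypergraph.
     three_graph H \<and> card (verts H) = n \<and> (\<forall>F\<in>\<F>. \<not> contains_copy H F)} \<noteq> {}"
proof -
  have "three_graph ({..<n}, {})" "card (verts ({..<n}, {})) = n"
    "\<forall>F\<in>\<F>. \<not> contains_copy ({..<n}, {}) F"
    using assms by (auto simp: three_graph_def contains_copy_def)
  then show ?thesis by blast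
qed

text \<open>The matching of \<open>k\<close> pairwise disjoint triples.\<close>

definition matching3 :: "nat \<Rightarrow> nat hypergraph" where
  "matching3 k = ({..<3 * k}, {{3 * i, 3 * i + 1, 3 * i + 2} | i. i < k})"

text \<open>The full star \<open>J\<^sub>t\<close> with center \<open>0\<close>.\<close>

definition full_star :: "nat \<Rightarrow> nat hypergraph" where
  "full_star t = ({..t}, {e. e \<subseteq> {..t} \<and> card e = 3 \<and> 0 \<in> e})"

text \<open>\<open>K\<^sub>4\<^sup>3\<^sup>-\<close>\<close>

definition K4_minus :: "nat hypergraph" where
  "K4_minus = ({0, 1, 2, 3}, {e. e \<subseteq> {0, 1, 2, 3} \<and> card e = 3} - {{1, 2, 3}})"

lemma full_star_3: "full_star 3 = K4_minus"
proof -
  have V: "{..3} = {0, 1, 2, 3 :: nat}" by auto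
  have "0 \<in> e \<longleftrightarrow> e \<noteq> {1, 2, 3}" if "e \<subseteq> {0, 1, 2, 3 :: nat}" "card e = 3" for e
  proof -
    have "e = {1, 2, 3}" if "0 \<notin> e"
      using \<open>e \<subseteq> _\<close> \<open>card e = 3\<close> that by (intro card_subset_eq) auto
    then show ?thesis by auto
  qed
  then show ?thesis unfolding full_star_def K4_minus_def V by auto
qed

text \<open>The Tur\'an graph \<open>T(n,k)\<close>, with the residue classes modulo \<open>k\<close> as its parts.\<close>

definition turan_graph :: "nat \<Rightarrow> nat \<Rightarrow> nat hypergraph" where
  "turan_graph n k = ({..<n}, {{i, j} | i j. i < n \<and> j < n \<and> i mod k \<noteq> j mod k})"

definition turan_size :: "nat \<Rightarrow> nat \<Rightarrow> nat" where
  "turan_size n k = card (edges (turan_graph n k))"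

lemma turan_graph_part_size:
  assumes "r < k"
  shows "card {i\<in>verts (turan_graph n k). i mod k = r}
    = n div k + (if r < n mod k then 1 else 0)"
proof -
  have "card {i. i < n \<and> i mod k = r} = n div k + (if r < n mod k then 1 else 0)"
  proof (induction n)
    case (Suc n)
    have "{i. i < Suc n \<and> i mod k = r} =
      (if n mod k = r then insert n {i. i < n \<and> i mod k = r} else {i. i < n \<and> i mod k = r})"
      by (auto simp: less_Suc_eq)
    then show ?case using Suc assms by (auto simp: div_Suc mod_Suc)
  qed simp
  then show ?thesis by (simp add: turan_graph_def)
qed

end

(*
  Upper bounds. The link of every vertex is K_t-free, so Turan's bound controls each degree. At
  most s vertices have degree above 3(s+1)n, since s+1 of them would carry a greedily built
  matching; the remaining edges meet a bounded set of vertices of linear degree. For t = 3 and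
  s = 2, a vertex b of large degree makes the edges avoiding b intersecting, so there are few of
  them unless they share a vertex; in that case two vertices cover all edges, and the number of
  edges is bounded exactly through the links of these two vertices.

  Lower bounds. Join s new vertices to the edges of a Turan graph; for s = 2 and n odd, the links
  of the two new vertices can be unbalanced so as to gain one edge.
*)
theory Submission
  imports Defs
begin
section \<open>Stars and matchings in terms of the edge set\<close>

text \<open>The exact count for t = 3 is tight only if at most s vertices cover all edges. In every
  other case the number of edges is at most a linear term, plus, for s = 2, one degree of about
  n^2/4 where the target is about n^2/2. The bound n \<ge> 150 lets the quadratic term win with
  explicit constants. The extra edge for s = 2 and n odd comes from rounding: n - 2 is odd, so
  Mantel's bound loses 1/4 in each of the two links, together half an edge. An edge through both
  cover vertices costs half an edge net when there is exactly one of them, which turns the floor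
  loss into a gain of one.\<close>

definition has_star :: "nat \<Rightarrow> 'a set set \<Rightarrow> bool" where
  "has_star t E \<longleftrightarrow> (\<exists>v K. card K = t \<and> v \<notin> K \<and> (\<forall>x\<in>K. \<forall>y\<in>K. x \<noteq> y \<longrightarrow> {v, x, y} \<in> E))"

lemma contains_full_star_iff:
  assumes "three_graph (V, E)" "t \<ge> 2"
  shows "contains_copy (V, E) (full_star t) \<longleftrightarrow> has_star t E"
proof
  assume "contains_copy (V, E) (full_star t)"
  then obtain f where f: "inj_on f {..t}" "f ` {..t} \<subseteq> V"
    and e: "\<And>e. e \<subseteq> {..t} \<Longrightarrow> card e = 3 \<Longrightarrow> 0 \<in> e \<Longrightarrow> f ` e \<in> E"
    unfolding contains_copy_def full_star_def by auto
  let ?K = "f ` {1..t}"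
  have "card ?K = t"
    using f(1) by (subst card_image) (auto intro: inj_on_subset)
  moreover have "f 0 \<notin> ?K"
  proof
    assume "f 0 \<in> ?K"
    then obtain j where "j \<in> {1..t}" "f 0 = f j" by auto
    with inj_onD[OF f(1), of 0 j] show False by auto
  qed
  moreover have "{f 0, x, y} \<in> E" if xy: "x \<in> ?K" "y \<in> ?K" "x \<noteq> y" for x y
  proof -
    obtain i j where ij: "i \<in> {1..t}" "j \<in> {1..t}" "x = f i" "y = f j" using xy by auto
    then have "i \<noteq> j" using xy by auto
    then have "f ` {0, i, j} \<in> E" using ij by (intro e) auto
    then show ?thesis using ij by simp
  qed
  ultimately show "has_star t E" unfolding has_star_def by blast
next
  assume "has_star t E"
  then obtain v K where K: "card K = t" "v \<notin> K"
    and E: "\<And>x y. x \<in> K \<Longrightarrow> y \<in> K \<Longrightarrow> x \<noteq> y \<Longrightarrow> {v, x, y} \<in> E"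
    unfolding has_star_def by blast
  have finK: "finite K" using K assms by (intro card_ge_0_finite) simp
  \<comment> \<open>Only vertices of edges are known to lie in \<open>V\<close>. Since t \<ge> 2,
    each x in K has a partner y in K, and {v, x, y} is an edge.\<close>
  have KV: "insert v K \<subseteq> V"
  proof -
    have "x \<in> V \<and> v \<in> V" if x: "x \<in> K" for x
    proof -
      have "card (K - {x}) > 0" using K x finK assms by simp
      then obtain y where "y \<in> K" "y \<noteq> x" by (metis DiffE card_gt_0_iff ex_in_conv singletonI)
      then have "{v, x, y} \<in> E" using E x by auto
      then show ?thesis using assms(1) unfolding three_graph_def by force
    qed
    moreover have "K \<noteq> {}" using K assms by auto
    ultimately show ?thesis by blast
  qed
  have "card {1..t} = card K" using K by simp
  then obtain g where g: "bij_betw g {1..t} K"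
    using finite_same_card_bij[of "{1..t}" K] finK by auto
  define f where "f i = (if i = 0 then v else g i)" for i
  have gK: "g i \<in> K" if "i \<in> {1..t}" for i using g that bij_betwE by blast
  have gi: "inj_on g {1..t}" using g by (simp add: bij_betw_def)
  have "inj_on f {..t}"
  proof (rule inj_onI)
    fix i j assume ij: "i \<in> {..t}" "j \<in> {..t}" "f i = f j"
    show "i = j"
    proof (cases "i = 0 \<or> j = 0")
      case True
      then show ?thesis using ij gK[of i] gK[of j] K(2) by (fastforce simp: f_def split: if_splits)
    next
      case False
      then have "i \<in> {1..t}" "j \<in> {1..t}" "g i = g j" using ij by (auto simp: f_def)
      then show ?thesis using gi inj_onD by metis
    qed
  qed
  moreover have "f ` {..t} \<subseteq> V" using KV gK by (auto simp: f_def)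
  moreover have "f ` e \<in> E" if e: "e \<subseteq> {..t}" "card e = 3" "0 \<in> e" for e
  proof -
    have "card (e - {0}) = 2" using e by (simp add: card_Diff_singleton)
    then obtain i j where ij: "e - {0} = {i, j}" "i \<noteq> j" by (auto simp: card_2_iff)
    then have "i \<in> e - {0}" "j \<in> e - {0}" by simp_all
    then have mem: "i \<in> {1..t}" "j \<in> {1..t}" using e by (auto simp: Suc_le_eq)
    have "e = {0, i, j}" using ij e by auto
    then have "f ` e = {v, g i, g j}" using mem by (auto simp: f_def)
    moreover have "g i \<noteq> g j" using inj_onD[OF gi _ mem] ij(2) by blast
    ultimately show ?thesis using E gK mem by simp
  qed
  ultimately show "contains_copy (V, E) (full_star t)"
    unfolding contains_copy_def full_star_def by auto
qed

lemma contains_matching3_iff: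
  assumes "three_graph (V, E)"
  shows "contains_copy (V, E) (matching3 k) \<longleftrightarrow> (\<exists>M\<subseteq>E. card M = k \<and> pairwise disjnt M)"
proof
  assume "contains_copy (V, E) (matching3 k)"
  then obtain f where f: "inj_on f {..<3 * k}" and fE: "\<forall>e\<in>edges (matching3 k). f ` e \<in> E"
    unfolding contains_copy_def by (auto simp: matching3_def)
  have e: "f ` {3 * i, 3 * i + 1, 3 * i + 2} \<in> E" if "i < k" for i
    using that by (intro fE[rule_format]) (auto simp: matching3_def)
  define B where "B i = {3 * i, 3 * i + 1, 3 * i + 2 :: nat}" for i
  define g where "g i = f ` B i" for i
  have B: "B i \<subseteq> {..<3 * k}" if "i < k" for i using that by (auto simp: B_def)
  have dis: "disjnt (g i) (g j)" if "i < k" "j < k" "i \<noteq> j" for i j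
  proof -
    have "B i \<inter> B j = {}" using that(3) unfolding B_def by (cases "i < j") auto
    then have "f ` B i \<inter> f ` B j = {}"
      using inj_on_image_Int[OF f B[OF that(1)] B[OF that(2)]] by simp
    then show ?thesis by (simp add: g_def disjnt_def)
  qed
  \<comment> \<open>Equal triples with different indices would be disjoint from themselves, hence
    empty.\<close>
  have inj: "inj_on g {..<k}"
  proof (rule inj_onI, rule ccontr)
    fix i j assume "i \<in> {..<k}" "j \<in> {..<k}" "g i = g j" "i \<noteq> j"
    then have "disjnt (g i) (g i)" using dis[of i j] by auto
    then show False by (auto simp: g_def B_def)
  qed
  have "g ` {..<k} \<subseteq> E" using e by (auto simp: g_def B_def)
  moreover have "card (g ` {..<k}) = k" using card_image[OF inj] by simp
  moreover have "pairwise disjnt (g ` {..<k})" using dis by (auto simp: pairwise_def)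
  ultimately show "\<exists>M\<subseteq>E. card M = k \<and> pairwise disjnt M" by blast
next
  assume "\<exists>M\<subseteq>E. card M = k \<and> pairwise disjnt M"
  then obtain M where M: "M \<subseteq> E" "card M = k" "pairwise disjnt M" by blast
  have "finite E" using assms finite_subset[of E "Pow V"] by (auto simp: three_graph_def)
  then have "finite M" using M finite_subset by blast
  then obtain g where g: "bij_betw g {..<k} M"
    using M finite_same_card_bij[of "{..<k}" M] by auto
  have gE: "g i \<in> E" if "i < k" for i using g M that bij_betwE by blast
  have "\<forall>i\<in>{..<k}. \<exists>h. bij_betw h {..<3::nat} (g i)"
  proof
    fix i assume "i \<in> {..<k}"
    then have "card (g i) = 3" using gE assms by (auto simp: three_graph_def)
    then show "\<exists>h. bij_betw h {..<3::nat} (g i)"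
      using finite_same_card_bij[of "{..<3::nat}" "g i"] by (simp add: card_ge_0_finite)
  qed
  then obtain h where h: "\<And>i. i < k \<Longrightarrow> bij_betw (h i) {..<3::nat} (g i)"
    by (metis lessThan_iff)
  \<comment> \<open>A label below 3k is read as the index of an edge of the matching and a position
    in it.\<close>
  define f where "f x = h (x div 3) (x mod 3)" for x
  have fg: "f x \<in> g (x div 3)" if "x < 3 * k" for x
  proof -
    have "x div 3 < k" using that by auto
    then show ?thesis using h bij_betwE unfolding f_def by fastforce
  qed
  have "inj_on f {..<3 * k}"
  proof (rule inj_onI)
    fix x y assume xy: "x \<in> {..<3 * k}" "y \<in> {..<3 * k}" "f x = f y"
    have lt: "x div 3 < k" "y div 3 < k" using xy by auto
    have "\<not> disjnt (g (x div 3)) (g (y div 3))" using xy fg[of x] fg[of y] by (auto simp: disjnt_iff)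
    then have "g (x div 3) = g (y div 3)"
      using M(3) g lt by (metis bij_betwE lessThan_iff pairwiseD)
    then have eq: "x div 3 = y div 3" using g lt by (auto simp: bij_betw_def inj_on_def)
    then have "x mod 3 = y mod 3"
      using h[OF lt(1)] xy by (auto simp: f_def bij_betw_def inj_on_def)
    with eq show "x = y" by (metis mult_div_mod_eq)
  qed
  moreover have "f ` {..<3 * k} \<subseteq> V"
  proof safe
    fix x assume "x < 3 * k"
    then have "x div 3 < k" by auto
    then have "g (x div 3) \<subseteq> V" using gE assms by (auto simp: three_graph_def)
    then show "f x \<in> V" using fg[OF \<open>x < 3 * k\<close>] by blast
  qed
  moreover have "f ` {3 * i, 3 * i + 1, 3 * i + 2} \<in> E" if "i < k" for i
  proof -
    have "(3 * i + 1) div 3 = i" "(3 * i + 2) div 3 = i" "(3 * i + 1) mod 3 = 1" "(3 * i + 2) mod 3 = 2"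
      by presburger+
    then have "f ` {3 * i, 3 * i + 1, 3 * i + 2} = h i ` {0, 1, 2}" by (simp add: f_def)
    also have "{0, 1, 2::nat} = {..<3}" by auto
    also have "h i ` {..<3} = g i" using h[OF that] by (simp add: bij_betw_def)
    finally show ?thesis using gE that by simp
  qed
  ultimately show "contains_copy (V, E) (matching3 k)"
    unfolding contains_copy_def matching3_def by auto
qed

text \<open>A subset of a matching is a matching, so excluding the size s + 1 excludes all larger
  sizes.\<close>

lemma not_matching3_iff:
  assumes "three_graph (V, E)"
  shows "\<not> contains_copy (V, E) (matching3 (s + 1)) \<longleftrightarrow> (\<forall>M\<subseteq>E. pairwise disjnt M \<longrightarrow> card M \<le> s)"
proof -
  have "\<exists>M'\<subseteq>E. card M' = s + 1 \<and> pairwise disjnt M'"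
    if "M \<subseteq> E" "pairwise disjnt M" "\<not> card M \<le> s" for M
  proof -
    have "s + 1 \<le> card M" using that by simp
    then obtain M' where "M' \<subseteq> M" "card M' = s + 1" by (meson obtain_subset_with_card_n)
    then show ?thesis using that by (meson order_trans pairwise_subset)
  qed
  moreover have "card M \<le> s"
    if "\<not> (\<exists>M\<subseteq>E. card M = s + 1 \<and> pairwise disjnt M)" "M \<subseteq> E" "pairwise disjnt M" for M
    using calculation that by blast
  ultimately show ?thesis unfolding contains_matching3_iff[OF assms]
    by (metis Suc_eq_plus1 not_less_eq_eq order_refl)
qed

lemma edges_full_star_nonempty: "t \<ge> 2 \<Longrightarrow> edges (full_star t) \<noteq> {}"
proof -
  assume "t \<ge> 2"
  then have "{0, 1, 2} \<in> edges (full_star t)" by (auto simp: full_star_def)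
  then show ?thesis by blast
qed

lemma edges_matching3_nonempty: "edges (matching3 (s + 1)) \<noteq> {}"
  by (auto simp: matching3_def)

lemma ex3_star_matching_le:
  assumes "t \<ge> 2"
    and "\<And>V E :: nat set set. three_graph (V, E) \<Longrightarrow> card V = n \<Longrightarrow> \<not> has_star t E \<Longrightarrow>
      \<forall>M\<subseteq>E. pairwise disjnt M \<longrightarrow> card M \<le> s \<Longrightarrow> card E \<le> b"
  shows "ex3 n {full_star t, matching3 (s + 1)} \<le> b"
  unfolding ex3_def
proof (subst Max_le_iff, goal_cases)
  case 1 show ?case by (rule finite_ex3)
next
  case 2 show ?case
    by (rule nonempty_ex3) (use edges_full_star_nonempty edges_matching3_nonempty assms(1) in auto)
next
  case 3
  show ?case
  proof clarsimp
    fix V :: "nat set" and E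
    assume "three_graph (V, E)" "n = card V" "\<not> contains_copy (V, E) (full_star t)"
      "\<not> contains_copy (V, E) (matching3 (Suc s))"
    then show "card E \<le> b"
      using assms(2)[of V E] contains_full_star_iff[of V E t] not_matching3_iff[of V E s] assms(1)
      by simp
  qed
qed

lemma ex3_star_matching_ge:
  fixes E :: "nat set set"
  assumes "t \<ge> 2" "three_graph (V, E)" "card V = n" "\<not> has_star t E"
    "\<forall>M\<subseteq>E. pairwise disjnt M \<longrightarrow> card M \<le> s"
  shows "card E \<le> ex3 n {full_star t, matching3 (s + 1)}"
  unfolding ex3_def
proof (rule Max_ge[OF finite_ex3], rule CollectI, intro exI[of _ "(V, E)"] conjI)
  show "\<forall>F\<in>{full_star t, matching3 (s + 1)}. \<not> contains_copy (V, E) F"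
    using contains_full_star_iff[OF assms(2,1)] not_matching3_iff[OF assms(2)] assms by simp
qed (use assms in auto)

section \<open>Tur\'an's bound\<close>

lemma card_Union_le_mult:
  assumes "finite S" "\<And>x. x \<in> S \<Longrightarrow> card (f x) \<le> b"
  shows "card (\<Union>x\<in>S. f x) \<le> card S * b"
proof -
  have "card (\<Union>x\<in>S. f x) \<le> (\<Sum>x\<in>S. card (f x))" by (rule card_UN_le[OF assms(1)])
  also have "\<dots> \<le> card S * b" using sum_bounded_above[of S "\<lambda>x. card (f x)" b] assms(2) by simp
  finally show ?thesis .
qed

text \<open>Split the edges at the neighbourhood of a vertex of maximum degree \<open>\<Delta>\<close>: the edges
  inside it are bounded by induction, and each of the remaining \<open>m - \<Delta>\<close> vertices meets at most
  \<open>\<Delta>\<close> edges.\<close>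

lemma turan_bound:
  assumes "finite W" "\<And>p. p \<in> G \<Longrightarrow> p \<subseteq> W \<and> card p = 2" "r \<ge> 1"
    and "\<And>K. K \<subseteq> W \<Longrightarrow> card K = r + 1 \<Longrightarrow> \<exists>x\<in>K. \<exists>y\<in>K. x \<noteq> y \<and> {x, y} \<notin> G"
  shows "2 * real r * real (card G) \<le> (real r - 1) * (real (card W))\<^sup>2"
  using assms(3,1,2,4)
proof (induction r arbitrary: W G rule: dec_induct)
  case base
  have "G = {}"
  proof (rule ccontr)
    assume "G \<noteq> {}"
    then obtain p where p: "p \<in> G" by blast
    then obtain x y where xy: "p = {x, y}" "x \<noteq> y" using base(2) by (meson card_2_iff)
    with base(3)[of p] base(2)[OF p] p show False by (auto simp: insert_commute)
  qed
  then show ?case by simp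
next
  case (step r)
  define N where "N x = {y. {x, y} \<in> G}" for x
  have NW: "N x \<subseteq> W" for x using step.prems(2) by (force simp: N_def)
  have NN: "x \<notin> N x" for x using step.prems(2)[of "{x}"] by (auto simp: N_def)
  have finN: "finite (N x)" for x using NW step.prems(1) finite_subset by blast
  show ?case
  proof (cases "W = {}")
    case True
    then have "G = {}" using step.prems(2) by force
    then show ?thesis by simp
  next
    case False
    define D where "D = Max ((\<lambda>x. card (N x)) ` W)"
    have "D \<in> (\<lambda>x. card (N x)) ` W" unfolding D_def
      by (rule Max_in) (use step.prems(1) False in auto)
    then obtain v where v: "v \<in> W" "card (N v) = D" by auto
    have le: "card (N x) \<le> D" if "x \<in> W" for x
      unfolding D_def using that step.prems(1) by simp
    define G' where "G' = {p\<in>G. p \<subseteq> N v}"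
    \<comment> \<open>In r + 1 neighbours of v together with v, the missing pair cannot contain v,
      so it lies among the neighbours: the induction hypothesis applies with r.\<close>
    have "2 * real r * real (card G') \<le> (real r - 1) * (real (card (N v)))\<^sup>2"
    proof (rule step.IH)
      fix K assume K: "K \<subseteq> N v" "card K = r + 1"
      have "insert v K \<subseteq> W" using K NW v by blast
      moreover have "v \<notin> K" "finite K" using K NN finN finite_subset by blast+
      then have "card (insert v K) = Suc r + 1" using K by simp
      ultimately obtain x y where xy: "x \<in> insert v K" "y \<in> insert v K" "x \<noteq> y" "{x, y} \<notin> G"
        using step.prems(3) by blast
      then have "x \<in> K" "y \<in> K" using K by (auto simp: N_def insert_commute)
      then show "\<exists>x\<in>K. \<exists>y\<in>K. x \<noteq> y \<and> {x, y} \<notin> G'" using xy G'_def by blast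
    qed (use finN step.prems(2) in \<open>auto simp: G'_def\<close>)
    moreover have "real (card G) \<le> real (card G') + (real (card W) - D) * D"
    proof -
      define R where "R = (\<Union>x\<in>W - N v. (\<lambda>y. {x, y}) ` N x)"
      have finR: "finite R" using step.prems(1) finN by (auto simp: R_def)
      have "finite G" using step.prems(1,2) finite_subset[of G "Pow W"] by auto
      have "card R \<le> card (W - N v) * D" unfolding R_def
      proof (rule card_Union_le_mult)
        fix x assume "x \<in> W - N v"
        then show "card ((\<lambda>y. {x, y}) ` N x) \<le> D"
          using le[of x] card_image_le[OF finN, of "\<lambda>y. {x, y}" x] by simp
      qed (use step.prems(1) in simp)
      moreover have "card (W - N v) = card W - D" using v NW finN by (simp add: card_Diff_subset)
      moreover have "D \<le> card W" using v NW step.prems(1) card_mono by metis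
      moreover have "G \<subseteq> G' \<union> R"
      proof
        fix p assume p: "p \<in> G"
        then obtain x y where xy: "p = {x, y}" "x \<noteq> y" using step.prems(2) by (meson card_2_iff)
        have "x \<in> W" "y \<in> W" using p xy step.prems(2) by auto
        moreover have "y \<in> N x" "x \<in> N y" using p xy by (auto simp: N_def insert_commute)
        ultimately show "p \<in> G' \<union> R"
          using p xy unfolding G'_def R_def by (cases "x \<in> N v"; cases "y \<in> N v") auto
      qed
      then have "card G \<le> card (G' \<union> R)" using finR \<open>finite G\<close>
        by (intro card_mono) (auto simp: G'_def)
      then have "card G \<le> card G' + card R" using card_Un_le[of G' R] by linarith
      ultimately have "card G \<le> card G' + (card W - D) * D" by simp
      then have "real (card G) \<le> real (card G' + (card W - D) * D)" by (simp only: of_nat_le_iff)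
      then show ?thesis using \<open>D \<le> card W\<close> by (simp add: of_nat_diff)
    qed
    ultimately have a: "2 * real r * real (card G') \<le> (real r - 1) * (real D)\<^sup>2"
      "real (card G) \<le> real (card G') + (real (card W) - D) * D" using v by auto
    have r: "real r \<ge> 1" using step.hyps by simp
    let ?m = "real (card W)"
    have "real r * (2 * (real r + 1) * card G)
        \<le> (real r + 1) * (2 * real r * card G' + 2 * real r * ((?m - D) * D))"
      using mult_left_mono[OF a(2), of "2 * real r * (real r + 1)"] r by (simp add: algebra_simps)
    also have "\<dots> \<le> (real r + 1) * ((real r - 1) * (real D)\<^sup>2 + 2 * real r * ((?m - D) * D))"
      using a(1) r by (intro mult_left_mono) auto
    \<comment> \<open>Completing the square in D. The discarded square vanishes at D = rm/(r+1), the
      degree in a balanced complete (r+1)-partite graph.\<close>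
    also have "\<dots> = (real r * ?m)\<^sup>2 - (real r * ?m - (real r + 1) * D)\<^sup>2"
      by (simp add: algebra_simps power2_eq_square)
    also have "\<dots> \<le> real r * (real r * ?m\<^sup>2)" by (simp add: power2_eq_square)
    finally show ?thesis using r by (simp add: add.commute)
  qed
qed

section \<open>Degrees, covers and greedy matchings\<close>

definition deg :: "'a set set \<Rightarrow> 'a \<Rightarrow> nat" where
  "deg E v = card {e\<in>E. v \<in> e}"

text \<open>The condition \<open>v \<notin> p\<close> makes \<open>insert v\<close> injective on the
  link; otherwise an edge e at v would be counted both through e and through e - {v}.\<close>

definition link :: "'a set set \<Rightarrow> 'a \<Rightarrow> 'a set set" where
  "link E v = {p. v \<notin> p \<and> insert v p \<in> E}"

lemma card_link: "card (link E v) = deg E v"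
proof -
  have "inj_on (insert v) (link E v)" by (rule inj_onI) (auto simp: link_def)
  moreover have "insert v ` link E v = {e\<in>E. v \<in> e}"
  proof (intro equalityI subsetI)
    fix e assume "e \<in> {e\<in>E. v \<in> e}"
    then have "e = insert v (e - {v})" "e - {v} \<in> link E v" by (auto simp: link_def insert_absorb)
    then show "e \<in> insert v ` link E v" by blast
  qed (auto simp: link_def)
  ultimately show ?thesis unfolding deg_def by (metis card_image)
qed

lemma three_graph_edge:
  assumes "three_graph (V, E)" "e \<in> E"
  shows "e \<subseteq> V" "card e = 3" "finite e"
  using assms by (auto simp: three_graph_def intro: card_ge_0_finite)

lemma three_graph_finite:
  assumes "three_graph (V, E)"
  shows "finite V" "finite E"
  using assms finite_subset[of E "Pow V"] by (auto simp: three_graph_def)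

lemma link_graph:
  assumes "three_graph (V, E)" "p \<in> link E v"
  shows "p \<subseteq> V - {v} \<and> card p = 2"
proof -
  have "insert v p \<in> E" "v \<notin> p" using assms(2) by (auto simp: link_def)
  then have "insert v p \<subseteq> V" "card (insert v p) = 3" "finite p"
    using three_graph_edge[OF assms(1), of "insert v p"] by auto
  then show ?thesis using \<open>v \<notin> p\<close> by auto
qed

lemma deg_le:
  assumes "three_graph (V, E)" "\<not> has_star (r + 1) E" "r \<ge> 1" "v \<in> V"
  shows "2 * real r * real (deg E v) \<le> (real r - 1) * (real (card V - 1))\<^sup>2"
proof -
  have "2 * real r * real (card (link E v)) \<le> (real r - 1) * (real (card (V - {v})))\<^sup>2"
  proof (rule turan_bound)
    fix K assume K: "K \<subseteq> V - {v}" "card K = r + 1"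
    then have "v \<notin> K" by auto
    then obtain x y where "x \<in> K" "y \<in> K" "x \<noteq> y" "{v, x, y} \<notin> E"
      using assms(2) K unfolding has_star_def by blast
    then show "\<exists>x\<in>K. \<exists>y\<in>K. x \<noteq> y \<and> {x, y} \<notin> link E v" by (auto simp: link_def)
  next
    show "p \<subseteq> V - {v} \<and> card p = 2" if "p \<in> link E v" for p by (rule link_graph[OF assms(1) that])
  qed (use assms(3) three_graph_finite[OF assms(1)] in auto)
  then show ?thesis using assms(4) three_graph_finite[OF assms(1)] by (simp add: card_link)
qed

lemma card_codegree_le:
  assumes "three_graph (V, E)" "v \<noteq> y"
  shows "card {e\<in>E. v \<in> e \<and> y \<in> e} \<le> card V"
proof -
  have "{e\<in>E. v \<in> e \<and> y \<in> e} \<subseteq> (\<lambda>z. {v, y, z}) ` V"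
  proof clarify
    fix e assume e: "e \<in> E" "v \<in> e" "y \<in> e"
    have "card (e - {v, y}) = 1"
      using three_graph_edge(2,3)[OF assms(1) e(1)] e(2,3) assms(2) by (simp add: card_Diff_subset)
    then obtain z where "e - {v, y} = {z}" by (auto simp: card_1_singleton_iff)
    then have "e = {v, y, z}" "z \<in> V" using e three_graph_edge[OF assms(1) e(1)] by blast+
    then show "e \<in> (\<lambda>z. {v, y, z}) ` V" by blast
  qed
  then show ?thesis using three_graph_finite[OF assms(1)] by (meson surj_card_le)
qed

lemma card_deg_meeting_le:
  assumes "three_graph (V, E)" "finite S" "v \<notin> S"
  shows "card {e\<in>E. v \<in> e \<and> e \<inter> S \<noteq> {}} \<le> card S * card V"
proof -
  have "{e\<in>E. v \<in> e \<and> e \<inter> S \<noteq> {}} = (\<Union>y\<in>S. {e\<in>E. v \<in> e \<and> y \<in> e})" by auto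
  also have "card \<dots> \<le> card S * card V"
  proof (rule card_Union_le_mult)
    fix y assume "y \<in> S"
    then have "v \<noteq> y" using assms(3) by auto
    then show "card {e\<in>E. v \<in> e \<and> y \<in> e} \<le> card V" by (rule card_codegree_le[OF assms(1)])
  qed (rule assms(2))
  finally show ?thesis .
qed

text \<open>At most |V| edges contain v and a given vertex of S, so at most |S||V| edges at v meet
  S; a larger degree leaves an edge over. This is how large degrees are exploited below.\<close>

lemma edge_avoiding:
  assumes "three_graph (V, E)" "finite S" "v \<notin> S" "deg E v > card S * card V"
  obtains e where "e \<in> E" "v \<in> e" "e \<inter> S = {}"
proof -
  have "card {e\<in>E. v \<in> e \<and> e \<inter> S \<noteq> {}} < card {e\<in>E. v \<in> e}"
    using card_deg_meeting_le[OF assms(1-3)] assms(4) unfolding deg_def by linarith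
  then have "{e\<in>E. v \<in> e} \<noteq> {e\<in>E. v \<in> e \<and> e \<inter> S \<noteq> {}}" by (metis less_irrefl)
  then show ?thesis using that by blast
qed

lemma card_edges_meeting_le:
  assumes "three_graph (V, E)" "finite S" "\<And>e. e \<in> F \<Longrightarrow> e \<in> E \<and> e \<inter> S \<noteq> {}"
    "\<And>v. v \<in> S \<Longrightarrow> deg E v \<le> b"
  shows "card F \<le> card S * b"
proof -
  have "F \<subseteq> (\<Union>v\<in>S. {e\<in>E. v \<in> e})" using assms(3) by blast
  then have "card F \<le> card (\<Union>v\<in>S. {e\<in>E. v \<in> e})"
    using assms(2) three_graph_finite[OF assms(1)] by (intro card_mono) auto
  also have "\<dots> \<le> card S * b"
    by (rule card_Union_le_mult) (use assms(2,4) in \<open>auto simp: deg_def\<close>)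
  finally show ?thesis .
qed

text \<open>The vertices of a maximum matching form a cover: an edge missing all of them could be
  added to the matching.\<close>

lemma cover_of_matching_number:
  assumes "three_graph (V, E)" "\<forall>M\<subseteq>E. pairwise disjnt M \<longrightarrow> card M \<le> s"
  obtains T where "finite T" "card T \<le> s * 3" "\<And>e. e \<in> E \<Longrightarrow> e \<inter> T \<noteq> {}"
proof -
  let ?P = "\<lambda>M. M \<subseteq> E \<and> pairwise disjnt M"
  have "?P {}" by simp
  moreover have "\<forall>M. ?P M \<longrightarrow> card M < s + 1" using assms(2) by auto
  ultimately obtain M where M: "?P M" "\<And>M'. ?P M' \<Longrightarrow> card M' \<le> card M"
    using ex_has_greatest_nat[of ?P "{}" card "s + 1"] by blast
  have finM: "finite M" using M three_graph_finite[OF assms(1)] finite_subset by blast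
  have sz: "card e = 3" "finite e" if "e \<in> E" for e
    using three_graph_edge[OF assms(1) that] by auto
  show ?thesis
  proof
    show "finite (\<Union>M)" using finM M sz by blast
    have "card (\<Union>e\<in>M. e) \<le> card M * 3"
      by (rule card_Union_le_mult) (use finM M sz in \<open>auto simp: subset_iff\<close>)
    moreover have "card M \<le> s" using assms(2) M by blast
    ultimately show "card (\<Union>M) \<le> s * 3" by simp
    fix e assume e: "e \<in> E"
    show "e \<inter> \<Union>M \<noteq> {}"
    proof
      assume dis: "e \<inter> \<Union>M = {}"
      then have "?P (insert e M)" using M(1) e by (auto simp: pairwise_insert disjnt_def)
      moreover have "e \<noteq> {}" using sz(1)[OF e] by auto
      then have "e \<notin> M" using dis by auto
      ultimately show False using M(2)[of "insert e M"] finM by simp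
    qed
  qed
qed

text \<open>S collects the vertices already used. The edge chosen at b avoids S and also the centres
  still to be treated, so these stay free. It adds three vertices to S while B loses one, hence
  \<open>card S + 3 * card B\<close> does not grow and the bound d persists.\<close>

lemma greedy_matching:
  assumes "three_graph (V, E)" "finite B" "finite S" "B \<inter> S = {}"
    "card S + 3 * card B \<le> d" "\<And>b. b \<in> B \<Longrightarrow> deg E b > d * card V"
  shows "\<exists>M\<subseteq>E. pairwise disjnt M \<and> card M = card B \<and> \<Union>M \<inter> S = {}"
  using assms(2-)
proof (induction B arbitrary: S)
  case empty
  then show ?case by (intro exI[of _ "{}"]) auto
next
  case (insert b B)
  have "card (S \<union> B) \<le> d" using insert card_Un_le[of S B] by simp
  then have "card (S \<union> B) * card V \<le> d * card V" by (rule mult_le_mono1)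
  also have "\<dots> < deg E b" by (rule insert.prems(4)) simp
  finally have "deg E b > card (S \<union> B) * card V" .
  then obtain e where e: "e \<in> E" "b \<in> e" "e \<inter> (S \<union> B) = {}"
    using edge_avoiding[OF assms(1), of "S \<union> B" b] insert by auto
  have sz: "card e = 3" "finite e" using three_graph_edge[OF assms(1) e(1)] by auto
  have "\<exists>M\<subseteq>E. pairwise disjnt M \<and> card M = card B \<and> \<Union>M \<inter> (S \<union> e) = {}"
  proof (rule insert.IH)
    show "card (S \<union> e) + 3 * card B \<le> d" using card_Un_le[of S e] insert sz by simp
  qed (use insert e sz in auto)
  then obtain M where M: "M \<subseteq> E" "pairwise disjnt M" "card M = card B" "\<Union>M \<inter> (S \<union> e) = {}"
    by blast
  have "finite M" using M three_graph_finite[OF assms(1)] finite_subset by blast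
  moreover have "e \<notin> M" using M e by blast
  ultimately have "card (insert e M) = card (insert b B)" using M insert by simp
  moreover have "pairwise disjnt (insert e M)" using M by (auto simp: pairwise_insert disjnt_def)
  moreover have "\<Union>(insert e M) \<inter> S = {}" using M e by auto
  ultimately show ?case using M e by (intro exI[of _ "insert e M"]) auto
qed

section \<open>The upper bound for arbitrary s and t\<close>

lemma card_edges_le_general:
  assumes "three_graph (V, E)" "r \<ge> 1" "\<not> has_star (r + 1) E"
    "\<forall>M\<subseteq>E. pairwise disjnt M \<longrightarrow> card M \<le> s"
  shows "2 * real r * card E
    \<le> s * ((real r - 1) * (real (card V))\<^sup>2) + 2 * real r * (9 * s * (s + 1)) * card V"
proof -
  let ?n = "card V"
  \<comment> \<open>The least value that admits s + 1 centres and an empty S in the greedy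
    construction.\<close>
  define d where "d = 3 * (s + 1)"
  define B where "B = {v\<in>V. deg E v > d * ?n}"
  have finB: "finite B" using three_graph_finite[OF assms(1)] by (simp add: B_def)
  have cB: "card B \<le> s"
  proof (rule ccontr)
    assume "\<not> card B \<le> s"
    then have "s + 1 \<le> card B" by simp
    then obtain B' where B': "B' \<subseteq> B" "card B' = s + 1" "finite B'"
      by (meson obtain_subset_with_card_n)
    have "\<exists>M\<subseteq>E. pairwise disjnt M \<and> card M = card B' \<and> \<Union>M \<inter> {} = {}"
      by (rule greedy_matching[OF assms(1) B'(3), where d = d]) (use B' in \<open>auto simp: d_def B_def\<close>)
    then obtain M where "M \<subseteq> E" "pairwise disjnt M" "card M = s + 1" using B' by auto
    then show False using assms(4) by auto
  qed
  obtain T where T: "finite T" "card T \<le> s * 3" "\<And>e. e \<in> E \<Longrightarrow> e \<inter> T \<noteq> {}"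
    using cover_of_matching_number[OF assms(1,4)] by blast
  define E1 where "E1 = {e\<in>E. e \<inter> B \<noteq> {}}"
  define E2 where "E2 = {e\<in>E. e \<inter> B = {}}"
  \<comment> \<open>Edges avoiding B still meet the cover T, in at most 3s vertices outside B, each
    of degree at most 3(s+1)n. Intersecting with \<open>V\<close> is needed since only vertices of
    \<open>V\<close> outside B have a degree bound.\<close>
  have "card E2 \<le> card (T \<inter> V - B) * (d * ?n)"
  proof (rule card_edges_meeting_le[OF assms(1)])
    fix e assume "e \<in> E2"
    then show "e \<in> E \<and> e \<inter> (T \<inter> V - B) \<noteq> {}"
      using T(3)[of e] three_graph_edge[OF assms(1), of e] by (auto simp: E2_def)
  qed (use T in \<open>auto simp: B_def\<close>)
  also have "\<dots> \<le> (s * 3) * (d * ?n)"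
    using T(2) card_mono[OF T(1), of "T \<inter> V - B"] by (intro mult_le_mono1) fastforce
  finally have "card E2 \<le> 9 * s * (s + 1) * ?n" by (simp add: d_def algebra_simps)
  then have "real (card E2) \<le> real (9 * s * (s + 1) * ?n)" by (simp only: of_nat_le_iff)
  then have E2: "real (card E2) \<le> (9 * s * (s + 1)) * real ?n" by simp
  have D: "2 * real r * real (deg E v) \<le> (real r - 1) * (real ?n)\<^sup>2" if "v \<in> V" for v
  proof -
    have "(real r - 1) * (real (?n - 1))\<^sup>2 \<le> (real r - 1) * (real ?n)\<^sup>2"
      using assms(2) by (intro mult_left_mono power_mono) auto
    then show ?thesis using deg_le[OF assms(1,3,2) that] by linarith
  qed
  have "card E1 \<le> (\<Sum>v\<in>B. deg E v)"
  proof -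
    have "E1 \<subseteq> (\<Union>v\<in>B. {e\<in>E. v \<in> e})" by (auto simp: E1_def)
    then have "card E1 \<le> card (\<Union>v\<in>B. {e\<in>E. v \<in> e})"
      using finB three_graph_finite[OF assms(1)] by (intro card_mono) auto
    also have "\<dots> \<le> (\<Sum>v\<in>B. deg E v)" unfolding deg_def by (rule card_UN_le[OF finB])
    finally show ?thesis .
  qed
  then have "real (card E1) \<le> (\<Sum>v\<in>B. real (deg E v))"
    by (metis of_nat_sum of_nat_le_iff)
  then have "2 * real r * card E1 \<le> 2 * real r * (\<Sum>v\<in>B. real (deg E v))"
    by (intro mult_left_mono) auto
  also have "\<dots> = (\<Sum>v\<in>B. 2 * real r * real (deg E v))" by (simp add: sum_distrib_left)
  also have "\<dots> \<le> (\<Sum>v\<in>B. (real r - 1) * (real ?n)\<^sup>2)"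
    by (rule sum_mono) (use D in \<open>auto simp: B_def\<close>)
  also have "\<dots> \<le> s * ((real r - 1) * (real ?n)\<^sup>2)"
    using cB assms(2) by (simp add: mult_right_mono)
  finally have E1: "2 * real r * card E1 \<le> s * ((real r - 1) * (real ?n)\<^sup>2)" .
  have "E = E1 \<union> E2" by (auto simp: E1_def E2_def)
  then have "card E \<le> card E1 + card E2" using card_Un_le by metis
  then have "2 * real r * card E \<le> 2 * real r * (card E1 + card E2)" by (intro mult_left_mono) auto
  also have "\<dots> \<le> s * ((real r - 1) * (real ?n)\<^sup>2) + 2 * real r * ((9 * s * (s + 1)) * real ?n)"
    using E1 mult_left_mono[OF E2, of "2 * real r"] by (simp add: distrib_left)
  finally show ?thesis by (simp add: algebra_simps)
qed

section \<open>Intersecting families and families with a cover of size two\<close>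

text \<open>All edges meet a fixed edge e. Each v in e is missed by some edge f, and every edge at v
  must meet f, so v has degree at most 3|V|; summing over the three vertices of e gives
  9|V|.\<close>

lemma card_nonstar_intersecting_le:
  assumes "three_graph (V, E)" "\<And>e f. e \<in> E \<Longrightarrow> f \<in> E \<Longrightarrow> e \<inter> f \<noteq> {}"
    "\<not> (\<exists>v\<in>V. \<forall>e\<in>E. v \<in> e)"
  shows "card E \<le> 9 * card V"
proof (cases "E = {}")
  case False
  then obtain e where e: "e \<in> E" by blast
  note ed = three_graph_edge[OF assms(1)]
  have "card E \<le> card e * (3 * card V)"
  proof (rule card_edges_meeting_le[OF assms(1) ed(3)[OF e]])
    fix v assume "v \<in> e"
    then have "v \<in> V" using ed(1)[OF e] by blast
    then obtain f where f: "f \<in> E" "v \<notin> f" using assms(3) by blast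
    have "{e\<in>E. v \<in> e} = {e\<in>E. v \<in> e \<and> e \<inter> f \<noteq> {}}" using assms(2) f by blast
    then show "deg E v \<le> 3 * card V" unfolding deg_def
      using card_deg_meeting_le[OF assms(1) ed(3)[OF f(1)] f(2)] ed(2)[OF f(1)] by simp
  qed (use assms(2) e in blast)
  then show ?thesis using ed(2)[OF e] by simp
qed simp

section \<open>Exact upper bounds for t = 3\<close>

lemma deg_le_mantel:
  assumes "three_graph (V, E)" "\<not> has_star 3 E" "v \<in> V"
  shows "deg E v \<le> (card V - 1)\<^sup>2 div 4"
proof -
  have "real (4 * deg E v) \<le> real ((card V - 1)\<^sup>2)"
    using deg_le[of V E 2 v] assms by simp
  then show ?thesis by linarith
qed

lemma card_le_intersecting:
  assumes "three_graph (V, E)" "\<not> has_star 3 E" "\<forall>M\<subseteq>E. pairwise disjnt M \<longrightarrow> card M \<le> 1"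
    "card V \<ge> 150"
  shows "card E \<le> (card V - 1)\<^sup>2 div 4"
proof (cases "\<exists>v\<in>V. \<forall>e\<in>E. v \<in> e")
  case True
  then obtain v where v: "v \<in> V" "\<forall>e\<in>E. v \<in> e" by blast
  then have "{e\<in>E. v \<in> e} = E" by blast
  then show ?thesis using deg_le_mantel[OF assms(1,2) v(1)] by (simp add: deg_def)
next
  case False
  have "e \<inter> f \<noteq> {}" if "e \<in> E" "f \<in> E" for e f
  proof
    assume "e \<inter> f = {}"
    moreover have "e \<noteq> {}" using three_graph_edge[OF assms(1) that(1)] by auto
    ultimately have "pairwise disjnt {e, f}" "card {e, f} = 2"
      by (auto simp: pairwise_insert disjnt_def card_insert_if)
    moreover have "{e, f} \<subseteq> E" using that by blast
    ultimately show False using assms(3)[rule_format, of "{e, f}"] by linarith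
  qed
  then have "card E \<le> 9 * card V" using card_nonstar_intersecting_le[OF assms(1) _ False] by blast
  also have "\<dots> \<le> (card V - 1)\<^sup>2 div 4"
  proof -
    obtain k where "card V = 150 + k" using assms(4) le_Suc_ex by blast
    then have "4 * (9 * card V) \<le> (card V - 1)\<^sup>2" by (simp add: power2_eq_square algebra_simps)
    then show ?thesis by linarith
  qed
  finally show ?thesis .
qed

text \<open>Replaces the floor by an equation with an explicit parity term, suited to linear
  arithmetic.\<close>

lemma sq_div_4_eq: "4 * (m\<^sup>2 div 4) + (if odd m then 1 else 0) = (m::nat)\<^sup>2"
proof (cases "even m")
  case True
  then obtain k where "m = 2 * k" by blast
  then show ?thesis by (simp add: power2_eq_square)
next
  case False
  then obtain k where "m = 2 * k + 1" by (rule oddE)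
  then have "m\<^sup>2 = 4 * (k * k + k) + 1" by (simp add: power2_eq_square algebra_simps)
  moreover have "(4 * q + 1) div 4 = q" for q :: nat by simp
  ultimately show ?thesis using False by presburger
qed

text \<open>Here w = |W - X| and k = |X|. The right side minus the left side is k^2/2 - k, plus 1/2
  if w is odd and 1/2 if w + k is odd. Only k = 1 makes the first part negative, namely -1/2, and
  then exactly one of w and w + 1 is odd.\<close>

lemma two_cover_arith:
  fixes w k :: nat
  shows "2 * (w\<^sup>2 div 4) + k * w + k \<le> 2 * ((w + k)\<^sup>2 div 4) + (if odd (w + k) then 1 else 0)"
proof -
  have a: "4 * (w\<^sup>2 div 4) + (if odd w then 1 else 0) = w\<^sup>2"
    and b: "4 * ((w + k)\<^sup>2 div 4) + (if odd (w + k) then 1 else 0) = w\<^sup>2 + 2 * (k * w) + k * k"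
    using sq_div_4_eq[of w] sq_div_4_eq[of "w + k"] by (simp_all add: power2_eq_square algebra_simps)
  consider "k = 0" | "k = 1" | "k \<ge> 2" by linarith
  then show ?thesis
  proof cases
    case 2
    then show ?thesis using a b by (cases "odd w") auto
  next
    case 3
    then have "2 * k \<le> k * k" by simp
    then show ?thesis using a b by linarith
  qed simp
qed

text \<open>Let \<open>G u\<close>, \<open>G v\<close> be the links of the two cover vertices inside the rest \<open>W\<close>, and \<open>X\<close> the
  set of third vertices of the edges through both \<open>u\<close> and \<open>v\<close>. As there is no star, \<open>X\<close> is
  independent in both graphs and \<open>x \<in> X\<close> has no common neighbour in them, so removing \<open>X\<close>
  costs at most \<open>|X| |W - X|\<close> pairs, and Mantel's theorem applies to what remains.\<close>

lemma card_le_two_cover: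
  assumes H: "three_graph (V, E)" and ns: "\<not> has_star 3 E"
    and uv: "u \<in> V" "v \<in> V" "u \<noteq> v" and cover: "\<And>e. e \<in> E \<Longrightarrow> u \<in> e \<or> v \<in> e"
  shows "card E \<le> 2 * ((card V - 2)\<^sup>2 div 4) + (if odd (card V - 2) then 1 else 0)"
proof -
  define W where "W = V - {u, v}"
  define X where "X = {x\<in>W. {u, v, x} \<in> E}"
  define G where "G c = {p. p \<subseteq> W \<and> insert c p \<in> E}" for c
  define N where "N c x = {y. {x, y} \<in> G c}" for c x
  note ed = three_graph_edge[OF H] and fin = three_graph_finite[OF H]
  have no_star: False if "x \<noteq> y" "x \<noteq> z" "y \<noteq> z" "w \<notin> {x, y, z}"
      "{w, x, y} \<in> E" "{w, x, z} \<in> E" "{w, y, z} \<in> E"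
    for w x y z
    using ns that unfolding has_star_def
  proof -
    have "has_star 3 E" unfolding has_star_def
      by (rule exI[of _ w], rule exI[of _ "{x, y, z}"]) (use that in \<open>auto simp: insert_commute\<close>)
    then show False using ns by blast
  qed
  have finW: "finite W" using fin by (simp add: W_def)
  have XW: "X \<subseteq> W" by (auto simp: X_def)
  have finX: "finite X" using finW XW finite_subset by blast
  have uW: "u \<notin> W" "v \<notin> W" by (auto simp: W_def)
  have cardW: "card W = card V - 2" using uv fin by (simp add: W_def card_Diff_subset)
  have G2: "p \<subseteq> W \<and> card p = 2" if "p \<in> G c" "c \<in> {u, v}" for p c
  proof -
    have p: "p \<subseteq> W" "insert c p \<in> E" using that by (auto simp: G_def)
    then have "c \<notin> p" using that uW by auto
    then show ?thesis using ed[OF p(2)] p by simp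
  qed
  have finG: "finite (G c)" for c
    using finW finite_subset[of "G c" "Pow W"] by (auto simp: G_def)
  have NX: "N c x \<subseteq> W - X" if "x \<in> X" "c \<in> {u, v}" for c x
  proof
    fix y assume "y \<in> N c x"
    then have p: "{x, y} \<in> G c" by (simp add: N_def)
    then have W: "x \<in> W" "y \<in> W" and e: "{c, x, y} \<in> E" and "x \<noteq> y"
      using G2[OF p that(2)] by (auto simp: G_def card_insert_if split: if_splits)
    have "y \<notin> X"
    proof
      assume "y \<in> X"
      \<comment> \<open>The other cover vertex. The edges {c, d, x}, {c, d, y} and {c, x, y} form a
        star with centre c.\<close>
      define d where "d = (if c = u then v else u)"
      have d: "{c, d} = {u, v}" "c \<noteq> d" using that(2) uv by (auto simp: d_def)
      have "{c, d, z} = {u, v, z}" for z using d by auto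
      then have "{c, d, x} \<in> E" "{c, d, y} \<in> E" using \<open>x \<in> X\<close> \<open>y \<in> X\<close> by (auto simp: X_def)
      moreover have "d \<notin> W" "c \<notin> W" using d uW by auto
      ultimately show False using no_star[of d x y c] W d \<open>x \<noteq> y\<close> e by auto
    qed
    then show "y \<in> W - X" using W by blast
  qed
  have NN: "N u x \<inter> N v x = {}" if x: "x \<in> X" for x
  proof (rule ccontr)
    assume "N u x \<inter> N v x \<noteq> {}"
    then obtain y where y: "{x, y} \<in> G u" "{x, y} \<in> G v" by (auto simp: N_def)
    then have W: "x \<in> W" "y \<in> W" "{u, x, y} \<in> E" "{v, x, y} \<in> E" and "x \<noteq> y"
      using G2[OF y(1)] by (auto simp: G_def card_insert_if split: if_splits)
    moreover have "{u, v, x} \<in> E" using x by (simp add: X_def)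
    \<comment> \<open>The forbidden star now has centre x and leaves u, v, y.\<close>
    moreover have "{x, u, y} = {u, x, y}" "{x, v, y} = {v, x, y}" "{x, u, v} = {u, v, x}" by auto
    ultimately show False using no_star[of u v y x] uW uv by auto
  qed
  have inner: "card {p\<in>G c. p \<inter> X = {}} \<le> (card (W - X))\<^sup>2 div 4" if c: "c \<in> {u, v}" for c
  proof -
    have "2 * real 2 * real (card {p\<in>G c. p \<inter> X = {}}) \<le> (real 2 - 1) * (real (card (W - X)))\<^sup>2"
    proof (rule turan_bound)
      fix p assume "p \<in> {p\<in>G c. p \<inter> X = {}}"
      then show "p \<subseteq> W - X \<and> card p = 2" using G2 c by blast
    next
      fix K assume K: "K \<subseteq> W - X" "card K = 2 + 1"
      then obtain x y z where xyz: "K = {x, y, z}" "x \<noteq> y" "y \<noteq> z" "x \<noteq> z"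
        by (auto simp: card_3_iff)
      have "c \<notin> K" using K uW c by auto
      then have "\<not> ({c, x, y} \<in> E \<and> {c, x, z} \<in> E \<and> {c, y, z} \<in> E)"
        using no_star[of x y z c] K xyz by auto
      then have "\<not> ({x, y} \<in> G c \<and> {x, z} \<in> G c \<and> {y, z} \<in> G c)" by (auto simp: G_def)
      then show "\<exists>x\<in>K. \<exists>y\<in>K. x \<noteq> y \<and> {x, y} \<notin> {p\<in>G c. p \<inter> X = {}}" using xyz by auto
    qed (use finW in auto)
    then have "real (4 * card {p\<in>G c. p \<inter> X = {}}) \<le> real ((card (W - X))\<^sup>2)" by simp
    then show ?thesis by linarith
  qed
  have outer: "card {p\<in>G c. p \<inter> X \<noteq> {}} \<le> (\<Sum>x\<in>X. card (N c x))" if c: "c \<in> {u, v}" for c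
  proof -
    have finN: "finite (N c x)" if "x \<in> X" for x using NX[OF that c] finW finite_subset by blast
    have "{p\<in>G c. p \<inter> X \<noteq> {}} \<subseteq> (\<Union>x\<in>X. (\<lambda>y. {x, y}) ` N c x)"
    proof
      fix p assume "p \<in> {p\<in>G c. p \<inter> X \<noteq> {}}"
      then obtain x where p: "p \<in> G c" "x \<in> p" "x \<in> X" by blast
      then obtain y where "p = {x, y}" using G2[OF p(1) c] by (auto simp: card_2_iff)
      then show "p \<in> (\<Union>x\<in>X. (\<lambda>y. {x, y}) ` N c x)" using p by (auto simp: N_def)
    qed
    then have "card {p\<in>G c. p \<inter> X \<noteq> {}} \<le> card (\<Union>x\<in>X. (\<lambda>y. {x, y}) ` N c x)"
      using finX finN by (intro card_mono) auto
    also have "\<dots> \<le> (\<Sum>x\<in>X. card ((\<lambda>y. {x, y}) ` N c x))" by (rule card_UN_le[OF finX])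
    also have "\<dots> \<le> (\<Sum>x\<in>X. card (N c x))"
      by (rule sum_mono) (rule card_image_le[OF finN])
    finally show ?thesis .
  qed
  have Gsplit: "card (G c) \<le> (card (W - X))\<^sup>2 div 4 + (\<Sum>x\<in>X. card (N c x))" if c: "c \<in> {u, v}" for c
  proof -
    have "G c = {p\<in>G c. p \<inter> X = {}} \<union> {p\<in>G c. p \<inter> X \<noteq> {}}" by auto
    from arg_cong[OF this, of card]
    have "card (G c) \<le> card {p\<in>G c. p \<inter> X = {}} + card {p\<in>G c. p \<inter> X \<noteq> {}}"
      by (rule ord_eq_le_trans[OF _ card_Un_le])
    then show ?thesis using inner[OF c] outer[OF c] by linarith
  qed
  have "(\<Sum>x\<in>X. card (N u x)) + (\<Sum>x\<in>X. card (N v x)) \<le> card X * card (W - X)"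
  proof -
    have "card (N u x) + card (N v x) \<le> card (W - X)" if x: "x \<in> X" for x
    proof -
      have sub: "N u x \<subseteq> W - X" "N v x \<subseteq> W - X" using NX[OF x] by auto
      then have "finite (N u x)" "finite (N v x)" using finW finite_subset finite_Diff by metis+
      then have "card (N u x) + card (N v x) = card (N u x \<union> N v x)"
        using NN[OF x] card_Un_disjoint by metis
      also have "\<dots> \<le> card (W - X)" using sub finW by (intro card_mono) auto
      finally show ?thesis .
    qed
    then have "(\<Sum>x\<in>X. card (N u x) + card (N v x)) \<le> (\<Sum>x\<in>X. card (W - X))" by (rule sum_mono)
    then show ?thesis by (simp add: sum.distrib)
  qed
  moreover have "card E \<le> card (G u) + card (G v) + card X"
  proof -
    have "E \<subseteq> insert u ` G u \<union> insert v ` G v \<union> (\<lambda>x. {u, v, x}) ` X"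
    proof
      fix e assume e: "e \<in> E"
      consider "u \<in> e" "v \<in> e" | "u \<in> e" "v \<notin> e" | "u \<notin> e" "v \<in> e" using cover[OF e] by blast
      then show "e \<in> insert u ` G u \<union> insert v ` G v \<union> (\<lambda>x. {u, v, x}) ` X"
      proof cases
        case 1
        then have "card (e - {u, v}) = 1" using ed(2,3)[OF e] uv by (simp add: card_Diff_subset)
        then obtain x where x: "e - {u, v} = {x}" by (auto simp: card_1_singleton_iff)
        then have "e = {u, v, x}" "x \<in> W" using 1 ed(1)[OF e] by (auto simp: W_def)
        then show ?thesis using e by (auto simp: X_def)
      next
        case 2
        then have "e = insert u (e - {u})" "e - {u} \<in> G u"
          using e ed(1)[OF e] by (auto simp: G_def W_def insert_absorb)
        then show ?thesis by blast
      next
        case 3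
        then have "e = insert v (e - {v})" "e - {v} \<in> G v"
          using e ed(1)[OF e] by (auto simp: G_def W_def insert_absorb)
        then show ?thesis by blast
      qed
    qed
    then have "card E \<le> card (insert u ` G u \<union> insert v ` G v \<union> (\<lambda>x. {u, v, x}) ` X)"
      using finG finX by (intro card_mono) auto
    also have "\<dots> \<le> card (insert u ` G u) + card (insert v ` G v) + card ((\<lambda>x. {u, v, x}) ` X)"
      by (meson add_le_mono card_Un_le le_refl order_trans)
    also have "\<dots> \<le> card (G u) + card (G v) + card X"
      by (intro add_mono card_image_le finG finX)
    finally show ?thesis .
  qed
  ultimately have "card E \<le> 2 * ((card (W - X))\<^sup>2 div 4) + card X * card (W - X) + card X"
    using Gsplit[of u] Gsplit[of v] by simp
  also have "\<dots> \<le> 2 * ((card (W - X) + card X)\<^sup>2 div 4) + (if odd (card (W - X) + card X) then 1 else 0)"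
    by (rule two_cover_arith)
  also have "card (W - X) + card X = card V - 2"
    using XW finX finW cardW card_mono[OF finW XW] by (simp add: card_Diff_subset)
  finally show ?thesis .
qed

lemma card_le_matching_number_two:
  assumes "three_graph (V, E)" "\<not> has_star 3 E" "\<forall>M\<subseteq>E. pairwise disjnt M \<longrightarrow> card M \<le> 2"
    "card V \<ge> 150"
  shows "card E \<le> 2 * ((card V - 2)\<^sup>2 div 4) + (if odd (card V - 2) then 1 else 0)"
proof -
  note ed = three_graph_edge[OF assms(1)] and fin = three_graph_finite[OF assms(1)]
  let ?n = "card V"
  obtain m where m: "?n = m + 2" "m \<ge> 148"
    using assms(4) by (intro that[of "?n - 2"]) auto
  define q where "q = m\<^sup>2 div 4"
  have q: "m * m \<le> 4 * q + 1" "m * m \<ge> 148 * m"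
    using sq_div_4_eq[of m] m by (auto simp: q_def power2_eq_square split: if_splits)
  have "card E \<le> 2 * q + (if odd m then 1 else 0)"
  \<comment> \<open>Two disjoint edges have 6 vertices, so a degree above 6n provides a third edge
    at b disjoint from both. If no degree is that large, the cover of 6 vertices leaves at most 36n
    edges.\<close>
  proof (cases "\<exists>b\<in>V. deg E b > 6 * ?n")
    case False
    obtain T where T: "finite T" "card T \<le> 2 * 3" "\<And>e. e \<in> E \<Longrightarrow> e \<inter> T \<noteq> {}"
      using cover_of_matching_number[OF assms(1,3)] by blast
    have "card E \<le> card (T \<inter> V) * (6 * ?n)"
    proof (rule card_edges_meeting_le[OF assms(1)])
      fix e assume "e \<in> E"
      then show "e \<in> E \<and> e \<inter> (T \<inter> V) \<noteq> {}" using T(3)[of e] ed(1)[of e] by blast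
    qed (use T False in auto)
    also have "\<dots> \<le> 6 * (6 * ?n)"
      using T(2) card_mono[OF T(1), of "T \<inter> V"] by (intro mult_le_mono1) fastforce
    finally show ?thesis using q m by linarith
  next
    case True
    then obtain b where b: "b \<in> V" "deg E b > 6 * ?n" by blast
    define E' where "E' = {e\<in>E. b \<notin> e}"
    have H': "three_graph (V - {b}, E')" using assms(1) by (auto simp: three_graph_def E'_def)
    have int: "e \<inter> f \<noteq> {}" if ef: "e \<in> E'" "f \<in> E'" for e f
    proof
      assume dis: "e \<inter> f = {}"
      have e: "e \<in> E" "b \<notin> e" and f: "f \<in> E" "b \<notin> f" using ef by (auto simp: E'_def)
      have "card (e \<union> f) \<le> 6" using card_Un_le[of e f] ed(2)[OF e(1)] ed(2)[OF f(1)] by simp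
      then have "card (e \<union> f) * ?n < deg E b"
        using b(2) mult_le_mono1[of "card (e \<union> f)" 6 ?n] by linarith
      then obtain g where g: "g \<in> E" "b \<in> g" "g \<inter> (e \<union> f) = {}"
        using edge_avoiding[OF assms(1), of "e \<union> f" b] ed(3)[OF e(1)] ed(3)[OF f(1)] e f by auto
      have "e \<noteq> {}" "f \<noteq> {}" "g \<noteq> {}" using ed(2) e f g by force+
      then have "card {e, f, g} = 3" "pairwise disjnt {e, f, g}"
        using dis g by (auto simp: card_insert_if pairwise_insert disjnt_def)
      moreover have "{e, f, g} \<subseteq> E" using e f g by blast
      ultimately show False using assms(3)[rule_format, of "{e, f, g}"] by linarith
    qed
    show ?thesis
    proof (cases "\<exists>v\<in>V - {b}. \<forall>e\<in>E'. v \<in> e")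
      case True
      then obtain v where "v \<in> V" "b \<noteq> v" "\<forall>e\<in>E'. v \<in> e" by blast
      moreover from this have "b \<in> e \<or> v \<in> e" if "e \<in> E" for e using that by (auto simp: E'_def)
      ultimately have "card E \<le> 2 * ((?n - 2)\<^sup>2 div 4) + (if odd (?n - 2) then 1 else 0)"
        by (intro card_le_two_cover[OF assms(1,2) b(1)])
      then show ?thesis using m by (simp add: q_def)
    next
      case False
      \<comment> \<open>Only b can contribute quadratically here: about m^2/4 edges at b and at most
        9(m + 1) others, against a target of about m^2/2.\<close>
      have "E = {e\<in>E. b \<in> e} \<union> E'" by (auto simp: E'_def)
      then have "card E \<le> deg E b + card E'" unfolding deg_def by (metis card_Un_le)
      moreover have "card E' \<le> 9 * card (V - {b})"
        using card_nonstar_intersecting_le[OF H' int False] by simp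
      moreover have "card (V - {b}) = m + 1" using b fin m by simp
      moreover have "deg E b \<le> (m + 1)\<^sup>2 div 4" using deg_le_mantel[OF assms(1,2) b(1)] m by simp
      moreover have "(m + 1)\<^sup>2 = m * m + 2 * m + 1" by (simp add: power2_eq_square)
      ultimately show ?thesis using q m by linarith
    qed
  qed
  then show ?thesis using m by (simp add: q_def)
qed

section \<open>The size of the Tur\'an graph\<close>

text \<open>Double counting of all ordered pairs below n, equal entries included: each edge occurs
  in two orders, and the pairs within one residue class contribute its squared size.\<close>

lemma turan_size_eq:
  assumes "k \<ge> 1"
  shows "2 * turan_size n k + (\<Sum>r<k. (card {i. i < n \<and> i mod k = r})\<^sup>2) = n\<^sup>2"
proof -
  define Q where "Q = {(i, j). i < n \<and> j < n \<and> i mod k = j mod k}"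
  define P where "P = {(i, j). i < n \<and> j < n \<and> i < j \<and> i mod k \<noteq> j mod k}"
  define P' where "P' = {(i, j). i < n \<and> j < n \<and> j < i \<and> i mod k \<noteq> j mod k}"
  have sub: "Q \<subseteq> {..<n} \<times> {..<n}" "P \<subseteq> {..<n} \<times> {..<n}" "P' \<subseteq> {..<n} \<times> {..<n}"
    by (auto simp: Q_def P_def P'_def)
  have fin: "finite Q" "finite P" "finite P'"
    by (rule finite_subset[OF sub(1)] finite_subset[OF sub(2)] finite_subset[OF sub(3)]; simp)+
  have "card P' = card P"
  proof -
    have "P' = prod.swap ` P" by (auto simp: P_def P'_def image_iff)
    then show ?thesis by (simp add: card_image)
  qed
  moreover have "turan_size n k = card P"
  proof -
    have "edges (turan_graph n k) = (\<lambda>(i, j). {i, j}) ` P"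
    proof (intro equalityI subsetI)
      fix e assume "e \<in> edges (turan_graph n k)"
      then obtain i j where e: "e = {i, j}" "i < n" "j < n" "i mod k \<noteq> j mod k"
        by (auto simp: turan_graph_def)
      then have "(i, j) \<in> P \<or> (j, i) \<in> P" by (cases i j rule: linorder_cases) (auto simp: P_def)
      then show "e \<in> (\<lambda>(i, j). {i, j}) ` P" using e(1) by (force simp: insert_commute)
    qed (auto simp: turan_graph_def P_def)
    moreover have "inj_on (\<lambda>(i, j). {i, j}) P"
      by (auto simp: inj_on_def P_def doubleton_eq_iff)
    ultimately show ?thesis unfolding turan_size_def by (metis card_image)
  qed
  moreover have "card Q = (\<Sum>r<k. (card {i. i < n \<and> i mod k = r})\<^sup>2)"
  proof -
    let ?C = "\<lambda>r. {i. i < n \<and> i mod k = r}"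
    have "Q = (\<Union>r<k. ?C r \<times> ?C r)" using assms by (auto simp: Q_def)
    also have "card \<dots> = (\<Sum>r<k. card (?C r \<times> ?C r))"
      by (rule card_UN_disjoint) auto
    finally show ?thesis by (simp add: card_cartesian_product power2_eq_square)
  qed
  moreover have "card P + card P' + card Q = n\<^sup>2"
  proof -
    have "{..<n} \<times> {..<n} = P \<union> P' \<union> Q" by (auto simp: P_def P'_def Q_def not_less nat_less_le)
    moreover have "card (P \<union> P' \<union> Q) = card P + card P' + card Q"
    proof -
      have "P \<inter> P' = {}" "(P \<union> P') \<inter> Q = {}" by (auto simp: P_def P'_def Q_def)
      then show ?thesis using fin by (simp add: card_Un_disjoint)
    qed
    moreover have "card ({..<n} \<times> {..<n}) = n\<^sup>2" by (simp add: card_cartesian_product power2_eq_square)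
    ultimately show ?thesis by simp
  qed
  ultimately show ?thesis by linarith
qed

lemma card_residue_class:
  assumes "r < k"
  shows "card {i. i < n \<and> i mod k = r} = n div k + (if r < n mod k then 1 else 0)"
  using turan_graph_part_size[OF assms, of n] by (simp add: turan_graph_def)

lemma turan_size_two: "turan_size n 2 = n\<^sup>2 div 4"
proof -
  have "{..<2::nat} = {0, 1}" by auto
  then have *: "2 * turan_size n 2 + ((n div 2 + (if 0 < n mod 2 then 1 else 0))\<^sup>2 + (n div 2)\<^sup>2) = n\<^sup>2"
    using turan_size_eq[of 2 n] card_residue_class[of 0 2 n] card_residue_class[of 1 2 n]
    by (cases "even n") (simp_all add: odd_iff_mod_2_eq_one)
  show ?thesis
  proof (cases "even n")
    case True
    then obtain k where "n = 2 * k" by blast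
    then show ?thesis using * by (simp add: power2_eq_square)
  next
    case False
    then obtain k where k: "n = 2 * k + 1" by (rule oddE)
    then have "n div 2 = k" "n mod 2 = 1" by auto
    then have "turan_size n 2 = k * k + k" using * k by (simp add: power2_eq_square algebra_simps)
    moreover have "n\<^sup>2 = 4 * (k * k + k) + 1" using k by (simp add: power2_eq_square algebra_simps)
    moreover have "(4 * q + 1) div 4 = q" for q :: nat by simp
    ultimately show ?thesis by presburger
  qed
qed

text \<open>Each class has at most m/r + 1 elements, so r times the sum of squares is at most (m +
  r)^2. Ignoring the exact balance of the parts costs only a linear term.\<close>

lemma turan_size_ge:
  assumes "r \<ge> 1"
  shows "2 * real r * real (turan_size m r) \<ge> (real r - 1) * (real m)\<^sup>2 - 2 * real r * m - (real r)\<^sup>2"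
proof -
  let ?S = "\<Sum>j<r. (card {i. i < m \<and> i mod r = j})\<^sup>2"
  have r: "real r > 0" using assms by simp
  have "real ?S \<le> (\<Sum>j<r. (real m / real r + 1)\<^sup>2)"
    unfolding of_nat_sum
  proof (rule sum_mono)
    fix j assume "j \<in> {..<r}"
    then have "card {i. i < m \<and> i mod r = j} \<le> m div r + 1" using card_residue_class[of j r m] by simp
    then have "real (card {i. i < m \<and> i mod r = j}) \<le> real (m div r) + 1" by simp
    also have "\<dots> \<le> real m / real r + 1"
      by (simp, metis floor_divide_of_nat_eq of_int_floor_le of_int_of_nat_eq)
    finally show "real ((card {i. i < m \<and> i mod r = j})\<^sup>2) \<le> (real m / real r + 1)\<^sup>2"
      by (simp add: power_mono)
  qed
  then have "real r * real ?S \<le> real r * (real r * (real m / real r + 1)\<^sup>2)"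
    using r by (intro mult_left_mono) auto
  also have "\<dots> = (real m)\<^sup>2 + 2 * real r * real m + (real r)\<^sup>2"
    using r by (simp add: power2_eq_square field_simps)
  finally have S: "real r * real ?S \<le> (real m)\<^sup>2 + 2 * real r * real m + (real r)\<^sup>2" .
  have "2 * real (turan_size m r) + real ?S = (real m)\<^sup>2"
    using arg_cong[OF turan_size_eq[OF assms, of m], of real] by simp
  then have "real r * (2 * real (turan_size m r) + real ?S) = real r * (real m)\<^sup>2" by simp
  then show ?thesis using S by (simp add: algebra_simps)
qed

section \<open>Constructions\<close>

text \<open>Pigeonhole: if each link is properly r-colourable, no link has a clique on r + 1
  vertices. The colouring may depend on w, which the constructions exploit.\<close>

lemma not_has_star_if_colored:
  assumes "r \<ge> 1"
    and "\<And>w. \<exists>c :: 'a \<Rightarrow> nat. \<forall>e\<in>E. w \<in> e \<longrightarrow> inj_on c (e - {w}) \<and> c ` (e - {w}) \<subseteq> {..<r}"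
  shows "\<not> has_star (r + 1) E"
proof
  assume "has_star (r + 1) E"
  then obtain w K where K: "card K = r + 1" "w \<notin> K"
    "\<And>x y. x \<in> K \<Longrightarrow> y \<in> K \<Longrightarrow> x \<noteq> y \<Longrightarrow> {w, x, y} \<in> E"
    unfolding has_star_def by blast
  obtain c :: "'a \<Rightarrow> nat"
    where c: "\<forall>e\<in>E. w \<in> e \<longrightarrow> inj_on c (e - {w}) \<and> c ` (e - {w}) \<subseteq> {..<r}"
    using assms(2)[of w] by blast
  have *: "c x \<noteq> c y \<and> c x < r" if "x \<in> K" "y \<in> K" "x \<noteq> y" for x y
  proof -
    have "{w, x, y} - {w} = {x, y}" using that K(2) by auto
    then have "inj_on c {x, y} \<and> c ` {x, y} \<subseteq> {..<r}"
      using c[rule_format, OF K(3)[OF that]] by simp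
    then show ?thesis using that(3) by auto
  qed
  have "finite K" using K(1) by (intro card_ge_0_finite) simp
  have "c ` K \<subseteq> {..<r}"
  proof clarify
    fix x assume x: "x \<in> K"
    then have "card (K - {x}) > 0" using K(1) assms(1) \<open>finite K\<close> by simp
    then obtain y where "y \<in> K" "y \<noteq> x" by (metis DiffE card_gt_0_iff ex_in_conv singletonI)
    then show "c x < r" using *[of x y] x by auto
  qed
  moreover have "inj_on c K" using * by (auto simp: inj_on_def)
  ultimately have "card K \<le> card {..<r}" by (intro card_inj_on_le) auto
  then show False using K(1) by simp
qed

text \<open>Disjoint edges select different vertices of the cover.\<close>

lemma card_matching_le_cover:
  assumes "finite S" "\<And>e. e \<in> E \<Longrightarrow> e \<inter> S \<noteq> {}"
  shows "\<forall>M\<subseteq>E. pairwise disjnt M \<longrightarrow> card M \<le> card S"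
proof (intro allI impI)
  fix M assume M: "M \<subseteq> E" "pairwise disjnt M"
  have "\<forall>e\<in>M. \<exists>x. x \<in> e \<inter> S" using assms(2) M(1) by blast
  then obtain g where g: "\<And>e. e \<in> M \<Longrightarrow> g e \<in> e \<inter> S" by metis
  have "inj_on g M"
  proof (rule inj_onI, rule ccontr)
    fix e f assume "e \<in> M" "f \<in> M" "g e = g f" "e \<noteq> f"
    then show False using g[of e] g[of f] pairwiseD[OF M(2), of e f] by (auto simp: disjnt_iff)
  qed
  then show "card M \<le> card S" using g assms(1) by (intro card_inj_on_le[of g]) auto
qed

lemma ex3_ge_turan:
  assumes "r \<ge> 2" "s \<le> n"
  shows "s * turan_size (n - s) r \<le> ex3 n {full_star (r + 1), matching3 (s + 1)}"
proof -
  define m where "m = n - s"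
  define T where "T = edges (turan_graph m r)"
  define S where "S = {m..<n}"
  define E where "E = (\<lambda>(c, p). insert c p) ` (S \<times> T)"
  have T: "p \<subseteq> {..<m} \<and> card p = 2 \<and> finite p \<and> inj_on (\<lambda>i. i mod r) p" if "p \<in> T" for p
    using that by (auto simp: T_def turan_graph_def inj_on_def card_insert_if)
  have S: "finite S" "card S = s" using assms by (auto simp: S_def m_def)
  have disj: "c \<notin> p" if "c \<in> S" "p \<in> T" for c p using that(1) T[OF that(2)] by (auto simp: S_def)
  have "inj_on (\<lambda>(c, p). insert c p) (S \<times> T)"
  proof (rule inj_onI, clarify)
    fix c p d q assume cp: "c \<in> S" "p \<in> T" "d \<in> S" "q \<in> T" and eq: "insert c p = insert d q"
    have "c \<notin> q" "d \<notin> p" using disj cp by auto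
    then have "c = d" using eq by blast
    moreover have "c \<notin> p" using disj cp by auto
    ultimately show "c = d \<and> p = q" using eq \<open>c \<notin> q\<close> by (simp add: insert_ident)
  qed
  then have cE: "card E = s * turan_size m r"
    using S by (simp add: E_def card_image card_cartesian_product turan_size_def T_def)
  have E: "\<exists>c p. e = insert c p \<and> c \<in> S \<and> p \<in> T" if "e \<in> E" for e
    using that by (auto simp: E_def)
  have "three_graph ({..<n}, E)"
    unfolding three_graph_def
  proof (clarsimp, intro conjI)
    fix e assume "e \<in> E"
    then obtain c p where e: "e = insert c p" "c \<in> S" "p \<in> T" using E by blast
    have "m \<le> n" by (simp add: m_def)
    then show "e \<subseteq> {..<n}" using e T[OF e(3)] by (auto simp: S_def)
    show "card e = 3" using e T[OF e(3)] disj by simp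
  qed
  moreover have "\<not> has_star (r + 1) E"
  proof (rule not_has_star_if_colored)
    fix w
    show "\<exists>c :: nat \<Rightarrow> nat. \<forall>e\<in>E. w \<in> e \<longrightarrow> inj_on c (e - {w}) \<and> c ` (e - {w}) \<subseteq> {..<r}"
    proof (cases "w \<in> S")
      case True
      have "inj_on (\<lambda>i. i mod r) (e - {w})" if e: "e \<in> E" "w \<in> e" for e
      proof -
        obtain c p where p: "e = insert c p" "c \<in> S" "p \<in> T" using E e by blast
        have "w \<notin> p" using disj[OF True p(3)] .
        then have "e - {w} = p" using p e(2) by auto
        then show ?thesis using T[OF p(3)] by simp
      qed
      then show ?thesis using assms(1) by (intro exI[of _ "\<lambda>i. i mod r"]) auto
    next
      case False
      \<comment> \<open>Outside S, every edge at w has exactly one vertex in S and one further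
        vertex outside S. The link of w is thus bipartite, and r \<ge> 2 colours suffice.\<close>
      define c where "c i = (if i \<in> S then 0 else 1 :: nat)" for i
      have "inj_on c (e - {w})" if e: "e \<in> E" "w \<in> e" for e
      proof -
        obtain d p where p: "e = insert d p" "d \<in> S" "p \<in> T" using E e by blast
        have "w \<in> p" using p False e by auto
        then obtain x where x: "p = {w, x}" "x \<noteq> w" using T[OF p(3)] by (auto simp: card_2_iff)
        have "x \<notin> S" using disj[OF _ p(3)] x by blast
        moreover have "e - {w} = {d, x}" using p x False by auto
        ultimately show ?thesis using p(2) by (auto simp: c_def)
      qed
      moreover have "c i < r" for i using assms(1) by (auto simp: c_def)
      ultimately show ?thesis by (intro exI[of _ c]) auto
    qed
  qed (use assms in auto)
  moreover have "\<forall>M\<subseteq>E. pairwise disjnt M \<longrightarrow> card M \<le> s"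
    using card_matching_le_cover[OF S(1), of E] E S(2) by blast
  ultimately show ?thesis
    using ex3_star_matching_ge[of "r + 1" "{..<n}" E n s] assms(1) cE by (simp add: m_def)
qed

lemma card_bipartite_cone:
  assumes "finite A" "finite B" "A \<inter> B = {}" "c \<notin> A \<union> B"
  shows "card ((\<lambda>(a, b). {c, a, b}) ` (A \<times> B)) = card A * card B"
proof -
  have "inj_on (\<lambda>(a, b). {c, a, b}) (A \<times> B)"
  proof (rule inj_onI, clarify)
    fix a b a' b' assume *: "a \<in> A" "b \<in> B" "a' \<in> A" "b' \<in> B" "{c, a, b} = {c, a', b'}"
    have "{c, a, b} \<inter> A = {a}" "{c, a', b'} \<inter> A = {a'}" "{c, a, b} \<inter> B = {b}" "{c, a', b'} \<inter> B = {b'}"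
      using assms(3,4) *(1-4) by auto
    then show "a = a' \<and> b = b'" using *(5) by (metis singleton_inject)
  qed
  then show ?thesis by (simp add: card_image card_cartesian_product)
qed

text \<open>For an odd number \<open>2k + 1\<close> of remaining vertices, let the links of the two cover vertices
  \<open>u\<close>, \<open>v\<close> differ in the side of one vertex \<open>x\<close>: then \<open>x\<close> has no common neighbour and
  the edge \<open>{u, v, x}\<close> can be added.\<close>

lemma ex3_two_ge_odd:
  assumes "n = 2 * k + 3"
  shows "2 * (k * (k + 1)) + 1 \<le> ex3 n {full_star 3, matching3 (2 + 1)}"
proof -
  define A where "A = {..<k}"
  define B where "B = {k..<2 * k}"
  define x u v where "x = 2 * k" and "u = 2 * k + 1" and "v = 2 * k + 2"
  define E1 where "E1 = (\<lambda>(a, b). {u, a, b}) ` (insert x A \<times> B)"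
  define E2 where "E2 = (\<lambda>(a, b). {v, a, b}) ` (A \<times> insert x B)"
  define E where "E = insert {u, v, x} (E1 \<union> E2)"
  have fin: "finite A" "finite B" "finite E1" "finite E2" by (auto simp: A_def B_def E1_def E2_def)
  have AB: "card A = k" "card B = k" "A \<inter> B = {}" by (auto simp: A_def B_def)
  have ne: "x \<notin> A" "x \<notin> B" "u \<notin> A" "u \<notin> B" "v \<notin> A" "v \<notin> B" "x \<noteq> u" "x \<noteq> v" "u \<noteq> v"
    by (auto simp: A_def B_def x_def u_def v_def)
  have "card E1 = (k + 1) * k" "card E2 = k * (k + 1)"
    unfolding E1_def E2_def using fin AB ne by (subst card_bipartite_cone; auto)+
  moreover have "E1 \<inter> E2 = {}"
  proof -
    have "v \<notin> e" if "e \<in> E1" for e using that ne by (auto simp: E1_def)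
    moreover have "v \<in> e" if "e \<in> E2" for e using that by (auto simp: E2_def)
    ultimately show ?thesis by blast
  qed
  moreover have "{u, v, x} \<notin> E1 \<union> E2"
  proof -
    have "v \<notin> e" if "e \<in> E1" for e using that ne by (auto simp: E1_def)
    moreover have "u \<notin> e" if "e \<in> E2" for e using that ne by (auto simp: E2_def)
    ultimately show ?thesis by blast
  qed
  ultimately have cE: "card E = 2 * (k * (k + 1)) + 1"
    unfolding E_def using fin by (simp add: card_Un_disjoint)
  have "three_graph ({..<n}, E)"
  proof -
    have "card e = 3" if "e \<in> E" for e
      using that ne AB(3) by (auto simp: E_def E1_def E2_def card_insert_if)
    moreover have "e \<subseteq> {..<n}" if "e \<in> E" for e
      using that assms by (auto simp: E_def E1_def E2_def A_def B_def x_def u_def v_def)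
    ultimately show ?thesis by (auto simp: three_graph_def)
  qed
  moreover have "\<not> has_star (2 + 1) E"
  proof (rule not_has_star_if_colored)
    fix w
    \<comment> \<open>One side of a bipartition of the link of w. The link of u joins
      \<open>insert x A\<close> to B, and x to v; that of v joins A to \<open>insert x B\<close>,
      and x to u. In the link of x, u is joined to B and v, and v to A. Every edge at another w
      contains exactly one of u, v.\<close>
    define P where "P = (if w = u then insert x A else if w = v then insert u A
      else if w = x then insert u A else {u, v})"
    define c where "c i = (if i \<in> P then 0 else 1 :: nat)" for i
    have "inj_on c (e - {w})" if e: "e \<in> E" "w \<in> e" for e
    proof -
      have two: "inj_on c (e - {w})" if "e - {w} \<subseteq> {p, q}" "p \<in> P \<longleftrightarrow> q \<notin> P" for p q
      proof (rule inj_on_subset[OF _ that(1)])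
        show "inj_on c {p, q}" using that(2) by (auto simp: c_def inj_on_def)
      qed
      have AB': "a \<noteq> b" if "a \<in> A" "b \<in> B" for a b using that AB(3) by auto
      consider "e = {u, v, x}" | a b where "e = {u, a, b}" "a \<in> insert x A" "b \<in> B"
        | a b where "e = {v, a, b}" "a \<in> A" "b \<in> insert x B"
        using e(1) by (auto simp: E_def E1_def E2_def)
      then show ?thesis
      proof cases
        case 1
        then consider "w = u" | "w = v" | "w = x" using e(2) by blast
        then show ?thesis
        proof cases
          case 1 then show ?thesis using \<open>e = _\<close> ne by (intro two[of v x]) (auto simp: P_def)
        next
          case 2 then show ?thesis using \<open>e = _\<close> ne by (intro two[of u x]) (auto simp: P_def)
        next
          case 3 then show ?thesis using \<open>e = _\<close> ne by (intro two[of u v]) (auto simp: P_def)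
        qed
      next
        case (2 a b)
        note 2 = this
        from 2 e(2) consider "w = u" | "w = a" | "w = b" by blast
        then show ?thesis
        proof cases
          case 1 then show ?thesis using 2 ne AB' by (intro two[of a b]) (auto simp: P_def)
        next
          case w: 2
          have "u \<in> P" "b \<notin> P" using w 2 ne AB' AB(3) by (auto simp: P_def)
          then show ?thesis using 2 w by (intro two[of u b]) auto
        next
          case w: 3
          have "w \<noteq> u" "w \<noteq> v" "w \<noteq> x" using w 2 ne by auto
          then have "P = {u, v}" by (simp add: P_def)
          then show ?thesis using 2 w ne by (intro two[of u a]) auto
        qed
      next
        case (3 a b)
        note 3 = this
        from 3 e(2) consider "w = v" | "w = a" | "w = b" by blast
        then show ?thesis
        proof cases
          case 1 then show ?thesis using 3 ne AB' by (intro two[of a b]) (auto simp: P_def)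
        next
          case w: 2
          have "w \<noteq> u" "w \<noteq> v" "w \<noteq> x" using w 3 ne by auto
          then have "P = {u, v}" by (simp add: P_def)
          then show ?thesis using 3 w ne by (intro two[of v b]) auto
        next
          case w: 3
          have "w \<noteq> u" "w \<noteq> v" using w 3 ne by auto
          then have "v \<in> P \<longleftrightarrow> a \<notin> P" using w 3 ne by (auto simp: P_def)
          then show ?thesis using 3 w by (intro two[of v a]) auto
        qed
      qed
    qed
    then show "\<exists>c :: nat \<Rightarrow> nat. \<forall>e\<in>E. w \<in> e \<longrightarrow> inj_on c (e - {w}) \<and> c ` (e - {w}) \<subseteq> {..<2}"
      by (intro exI[of _ c]) (auto simp: c_def)
  qed simp
  moreover have "\<forall>M\<subseteq>E. pairwise disjnt M \<longrightarrow> card M \<le> 2"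
  proof -
    have "e \<inter> {u, v} \<noteq> {}" if "e \<in> E" for e using that by (auto simp: E_def E1_def E2_def)
    moreover have "card {u, v} = 2" using ne by simp
    ultimately show ?thesis using card_matching_le_cover[of "{u, v}" E] by simp
  qed
  ultimately show ?thesis
    using ex3_star_matching_ge[of 3 "{..<n}" E n 2] cE by simp
qed

section \<open>The extremal numbers\<close>

lemma ex3_le_general:
  assumes "r \<ge> 1"
  shows "2 * real r * real (ex3 n {full_star (r + 1), matching3 (s + 1)})
    \<le> s * ((real r - 1) * (real n)\<^sup>2) + 2 * real r * (9 * s * (s + 1)) * n" (is "_ \<le> ?b")
proof -
  have r: "2 * real r > 0" using assms by simp
  have "ex3 n {full_star (r + 1), matching3 (s + 1)} \<le> nat \<lfloor>?b / (2 * real r)\<rfloor>"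
  proof (rule ex3_star_matching_le)
    fix V :: "nat set" and E
    assume "three_graph (V, E)" "card V = n" "\<not> has_star (r + 1) E"
      "\<forall>M\<subseteq>E. pairwise disjnt M \<longrightarrow> card M \<le> s"
    then have "2 * real r * card E \<le> ?b" using card_edges_le_general[of V E r s] assms by simp
    then have "real (card E) \<le> ?b / (2 * real r)" using r by (simp add: field_simps)
    then show "card E \<le> nat \<lfloor>?b / (2 * real r)\<rfloor>" by (rule le_nat_floor)
  qed (use assms in simp)
  then have "real (ex3 n {full_star (r + 1), matching3 (s + 1)}) \<le> real (nat \<lfloor>?b / (2 * real r)\<rfloor>)"
    by (simp only: of_nat_le_iff)
  also have "\<dots> \<le> ?b / (2 * real r)" using assms by (intro of_nat_floor) simp
  finally show ?thesis using r by (simp add: field_simps)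
qed

lemma ex3_minus_turan_bigo:
  assumes "r \<ge> 2"
  shows "(\<lambda>n. real (ex3 n {full_star (r + 1), matching3 (s + 1)}) - real (s * turan_size (n - s) r))
    \<in> O(\<lambda>n. real n)"
proof -
  define R where "R = real r"
  define S where "S = real s"
  define C where "C = 2 * R * (9 * S * (S + 1)) + 2 * (R - 1) * S * S + 2 * R * S + R\<^sup>2 * S"
  have R: "R \<ge> 2" and S: "S \<ge> 0" using assms by (simp_all add: R_def S_def)
  show ?thesis
  proof (rule bigoI[of _ C], rule eventually_sequentiallyI[of "s + 1"])
    fix n assume n: "s + 1 \<le> n"
    define x where "x = real (ex3 n {full_star (r + 1), matching3 (s + 1)})"
    define y where "y = real (turan_size (n - s) r)"
    have "S * y \<le> x" using ex3_ge_turan[of r s n] assms n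
      by (simp add: x_def y_def S_def flip: of_nat_mult)
    have nn: "real n \<ge> 1" "real (n - s) = real n - S" using n by (auto simp: S_def of_nat_diff)
    have x: "2 * R * x \<le> S * ((R - 1) * (real n)\<^sup>2) + 2 * R * (9 * S * (S + 1)) * n"
      using ex3_le_general[of r n s] assms by (simp add: x_def R_def S_def)
    have "2 * R * y \<ge> (R - 1) * (real n - S)\<^sup>2 - 2 * R * (real n - S) - R\<^sup>2"
      using turan_size_ge[of r "n - s"] assms unfolding nn(2) y_def R_def by simp
    moreover have "(R - 1) * (real n - S)\<^sup>2 \<ge> (R - 1) * ((real n)\<^sup>2 - 2 * S * n)"
      using R by (intro mult_left_mono) (simp_all add: power2_eq_square algebra_simps)
    moreover have "R\<^sup>2 \<le> R\<^sup>2 * real n" using nn(1) R by simp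
    moreover have "2 * R * (real n - S) \<le> 2 * R * n" using R S by simp
    ultimately have "2 * R * y \<ge> (R - 1) * ((real n)\<^sup>2 - 2 * S * n) - 2 * R * n - R\<^sup>2 * n" by linarith
    then have "S * (2 * R * y) \<ge> S * ((R - 1) * ((real n)\<^sup>2 - 2 * S * n) - 2 * R * n - R\<^sup>2 * n)"
      using S by (intro mult_left_mono)
    then have le: "2 * R * (x - S * y) \<le> C * n"
      using x by (simp add: C_def algebra_simps power2_eq_square)
    \<comment> \<open>The difference is nonnegative by the construction, so the factor 2R \<ge> 1
      can simply be dropped.\<close>
    have "1 * (x - S * y) \<le> 2 * R * (x - S * y)"
      using R \<open>S * y \<le> x\<close> by (intro mult_right_mono) auto
    from order_trans[OF this le] have "x - S * y \<le> C * n" by simp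
    then show "norm (real (ex3 n {full_star (r + 1), matching3 (s + 1)}) - real (s * turan_size (n - s) r))
        \<le> C * norm (real n)"
      using \<open>S * y \<le> x\<close> by (simp add: x_def y_def S_def)
  qed
qed

lemma ex3_K4_minus_one:
  assumes "n \<ge> 150"
  shows "ex3 n {K4_minus, matching3 (1 + 1)} = (n - 1)\<^sup>2 div 4"
  unfolding full_star_3[symmetric]
proof (rule antisym)
  show "ex3 n {full_star 3, matching3 (1 + 1)} \<le> (n - 1)\<^sup>2 div 4"
    by (rule ex3_star_matching_le) (use card_le_intersecting assms in auto)
  show "(n - 1)\<^sup>2 div 4 \<le> ex3 n {full_star 3, matching3 (1 + 1)}"
    using ex3_ge_turan[of 2 1 n] assms by (simp add: turan_size_two)
qed

lemma ex3_K4_minus_two: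
  assumes "n \<ge> 150"
  shows "ex3 n {K4_minus, matching3 (2 + 1)} = 2 * ((n - 2)\<^sup>2 div 4) + (if odd n then 1 else 0)"
  unfolding full_star_3[symmetric]
proof (rule antisym)
  show "ex3 n {full_star 3, matching3 (2 + 1)} \<le> 2 * ((n - 2)\<^sup>2 div 4) + (if odd n then 1 else 0)"
  proof (rule ex3_star_matching_le)
    fix V :: "nat set" and E
    assume "three_graph (V, E)" "card V = n" "\<not> has_star 3 E"
      "\<forall>M\<subseteq>E. pairwise disjnt M \<longrightarrow> card M \<le> 2"
    moreover have "odd (n - 2) \<longleftrightarrow> odd n" using assms by simp
    ultimately show "card E \<le> 2 * ((n - 2)\<^sup>2 div 4) + (if odd n then 1 else 0)"
      using card_le_matching_number_two[of V E] assms by simp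
  qed simp
  show "2 * ((n - 2)\<^sup>2 div 4) + (if odd n then 1 else 0) \<le> ex3 n {full_star 3, matching3 (2 + 1)}"
  proof (cases "even n")
    case True
    then show ?thesis using ex3_ge_turan[of 2 2 n] assms by (simp add: turan_size_two)
  next
    case False
    then have "odd (n - 2)" using assms by simp
    then obtain k where k: "n - 2 = 2 * k + 1" by (rule oddE)
    then have "4 * ((n - 2)\<^sup>2 div 4) + 1 = 4 * (k * (k + 1)) + 1"
      using sq_div_4_eq[of "n - 2"] by (simp add: power2_eq_square algebra_simps)
    moreover have "n = 2 * k + 3" using k by simp
    ultimately show ?thesis using ex3_two_ge_odd[of n k] False by simp
  qed
qed

theorem theorem1p7:
  "(\<forall>s t :: nat. s \<ge> 1 \<longrightarrow> t \<ge> 3 \<longrightarrow>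
      (\<lambda>n. real (ex3 n {full_star t, matching3 (s + 1)}) - real (s * turan_size (n - s) (t - 1)))
        \<in> O(\<lambda>n. real n))
   \<and> (\<forall>s n :: nat. s \<in> {1, 2} \<longrightarrow> n \<ge> 150 \<longrightarrow>
      int (ex3 n {K4_minus, matching3 (s + 1)}) =
        (if s = 2 \<and> odd n then 2 * \<lfloor>(real n - 2)\<^sup>2 / 4\<rfloor> + 1
         else int s * \<lfloor>(real n - real s)\<^sup>2 / 4\<rfloor>))"
proof (intro conjI allI impI)
  fix s t :: nat
  assume "t \<ge> 3"
  then obtain r where "t = r + 1" "r \<ge> 2" by (intro that[of "t - 1"]) auto
  then show "(\<lambda>n. real (ex3 n {full_star t, matching3 (s + 1)}) - real (s * turan_size (n - s) (t - 1)))
      \<in> O(\<lambda>n. real n)"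
    using ex3_minus_turan_bigo[of r s] by simp
next
  fix s n :: nat
  assume s: "s \<in> {1, 2}" and n: "n \<ge> 150"
  have fl: "\<lfloor>(real n - real k)\<^sup>2 / 4\<rfloor> = int ((n - k)\<^sup>2 div 4)" if "k \<le> n" for k
    using floor_divide_of_nat_eq[of "(n - k)\<^sup>2" 4, where 'a = real] that by (simp add: of_nat_diff)
  show "int (ex3 n {K4_minus, matching3 (s + 1)}) =
        (if s = 2 \<and> odd n then 2 * \<lfloor>(real n - 2)\<^sup>2 / 4\<rfloor> + 1
         else int s * \<lfloor>(real n - real s)\<^sup>2 / 4\<rfloor>)"
  proof (cases "s = 1")
    case True
    then show ?thesis using ex3_K4_minus_one[OF n] fl[of 1] n by simp
  next
    case False
    then have "s = 2" using s by simp
    then show ?thesis using ex3_K4_minus_two[OF n] fl[of 2] n by simp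
  qed
qed

end
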